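(* (i) Let $c,\theta\in\mathbb{R}$ with $c\neq 0$ and $\theta\notin\{0,1\}$. Then the sequence $(\mathrm{e}^{c n^\theta})_{n\ge 1}$ is non-holonomic. In particular, the sequences $\mathrm{e}^{\sqrt n}$, $\mathrm{e}^{-\sqrt n}$, $\mathrm{e}^{1/n}$, $\mathrm{e}^{-1/n}$ ($n\ge1$) are non-holonomic. (ii) Each of the following sequences (indexed by $n\ge 1$) is also non-holonomic: $$\frac{1}{2^n+1},\quad \frac{1}{2^n-1},\quad \frac{1}{n!+1},\quad \Gamma(n\sqrt2),\quad \frac{\Gamma(n\sqrt2)}{\Gamma(n\sqrt3)},\quad \Gamma(n\,\mathrm{i}),\quad \frac{1}{\zeta(n+2)}.$$
   Context: A sequence $(f_n)$ of complex numbers is called holonomic (or $P$-recursive) if there exist an integer $d\ge 0$ and polynomials $p_0,\dots,p_d\in\mathbb{C}[n]$ with $p_0\not\equiv 0$ such that $\sum_{k=0}^d p_k(n) f_{n-k}=0$ for all $n$ for which all the terms $f_n,\dots,f_{n-d}$ are defined. Equivalently, its generating function $f(z)=\sum_n f_n z^n$ satisfies a linear differential equation $\sum_{k=0}^e q_k(z) f^{(k)}(z)=0$ with $q_k\in\mathbb{C}[z]$ and $q_e\not\equiv0$. A sequence is non-holonomic if it is not holonomic. Here $\Gamma$ is the Euler Gamma function, $\zeta$ is the Riemann zeta function, and $\mathrm{i}=\sqrt{-1}$. *)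

theory Defs
  imports "HOL-Analysis.Analysis" "HOL-Computational_Algebra.Polynomial"
begin

(* The sequence consists of the values f n for n >= m. The values of f below m are junk:
   the recurrence is required exactly where all of f n, ..., f (n - d) are terms of
   the sequence, so the subtraction n - k never truncates. Only p 0, ..., p d matter. *)
definition holonomic_from :: "nat \<Rightarrow> (nat \<Rightarrow> complex) \<Rightarrow> bool" where
  "holonomic_from m f \<longleftrightarrow>
     (\<exists>(d::nat) (p :: nat \<Rightarrow> complex poly). p 0 \<noteq> 0 \<and>
        (\<forall>n\<ge>m + d. (\<Sum>k\<le>d. poly (p k) (of_nat n) * f (n - k)) = 0))"

(* The Dirichlet series of the Riemann zeta function; this is zeta only on the half-plane
   Re s > 1, where the series converges (the value elsewhere is not the continuation). *)
definition zeta :: "complex \<Rightarrow> complex" where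
  "zeta s = (\<Sum>k. 1 / of_nat (Suc k) powr s)"

end

theory Submission
  imports Defs "HOL-Complex_Analysis.Complex_Analysis" "HOL-Real_Asymp.Real_Asymp"
    "HOL-Computational_Algebra.Squarefree"
begin

text \<open>
  A recurrence for \<open>f\<close> is a linear relation with polynomial coefficients between the shifts
  \<open>n \<mapsto> f (n - k)\<close>. For each of the sequences the shifts turn out to be linearly independent over
  the polynomials, so that every coefficient of a recurrence vanishes. Three different reasons
  for independence are used.

  Separated scales. If finitely many sequences are such that of any two one is smaller than the other
  by a factor that beats every power of \<open>n\<close>, a relation with polynomial coefficients must be
  trivial, because its largest term cannot be cancelled (\<open>separated_scales\<close>). For \<open>\<theta> > 1\<close> the
  shifts of \<open>exp (c n\<^sup>\<theta>)\<close> are themselves such sequences. For \<open>1 / (2 ^ n \<plusminus> 1)\<close> and \<open>1 / (n! + 1)\<close>,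
  clearing denominators yields a polynomial relation between \<open>n\<close> and \<open>u = 2 ^ n\<close> or \<open>u = n!\<close>, hence
  an identity of polynomials in two variables; at the value of \<open>u\<close> where one of the denominators
  vanishes only one of its summands survives. Finally, \<open>1 / \<zeta> (n + 2)\<close> is a Dirichlet
  series \<open>\<Sum>j. \<mu> (j) j\<^sup>-\<^sup>2 j\<^sup>-\<^sup>n\<close>; comparing the terms \<open>j\<^sup>-\<^sup>n\<close> of a recurrence with coefficients \<open>p\<^sub>k\<close>
  gives \<open>\<Sum>k. p\<^sub>k j\<^sup>k = 0\<close> whenever \<open>\<mu> (j) \<noteq> 0\<close>, which for infinitely many \<open>j\<close> forces \<open>p\<^sub>k = 0\<close>.

  Incommensurable powers. For the sequences built from \<open>\<Gamma> (n \<omega>)\<close> the quotient \<open>f (n - k) / f n\<close>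
  is asymptotic to a constant times \<open>n\<^sup>-\<^sup>k\<^sup>\<alpha>\<close>, where \<open>\<alpha>\<close> is \<open>\<omega>\<close> or a difference of two such numbers. For
  real irrational \<open>\<alpha>\<close> the terms of a recurrence then have pairwise different orders of growth. For
  \<open>\<alpha>\<close> off the real line several terms may have the same order, but their sum divided by that order is
  nearly a fixed polynomial at the point \<open>exp (- \<i> Im \<alpha> ln n)\<close>, and these points accumulate
  everywhere on the unit circle (\<open>not_holonomic_power_ratio\<close>).

  Continuation to a singularity. For \<open>\<theta> < 1\<close> all the shifts of \<open>exp (c n\<^sup>\<theta>)\<close> are asymptotically
  equal, and growth alone does not decide. Consider the function
  \<open>F x = \<Sum>k\<le>D. p\<^sub>k (x) exp (c (x - k)\<^sup>\<theta>)\<close> of a real variable, where \<open>p\<^sub>D \<noteq> 0\<close>. By repeated use of Rolle's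
  theorem it has no arbitrarily large zeros unless it vanishes for all large \<open>x\<close>; as it is zero at all
  large integers, it does vanish there (\<open>exp_power_sum_eventually_zero\<close>), and then so does its analytic
  continuation to \<open>Re z > D\<close>. But only the last summand is singular at \<open>z = D\<close>. In the coordinate
  \<open>z = D + exp t\<close> this says that \<open>Q (exp t) exp (c exp (\<theta> t))\<close>, with a nonzero polynomial \<open>Q\<close>,
  is an analytic function of \<open>exp t\<close> near \<open>0\<close>. For \<open>0 < \<theta> < 1\<close> this is absurd since it is not
  periodic with period \<open>2 \<pi> \<i>\<close>, and for \<open>\<theta> < 0\<close> since it is unbounded as \<open>Re t\<close> tends to minus
  infinity along a suitable horizontal line.
\<close>

section \<open>Linear independence of sequences on separated scales\<close>

text \<open>
  The quotient decays faster than every power of \<open>n\<close>, so that no polynomial coefficient can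
  bridge the gap between \<open>u\<close> and \<open>v\<close>.
\<close>

definition negligible :: "(nat \<Rightarrow> complex) \<Rightarrow> (nat \<Rightarrow> complex) \<Rightarrow> bool" where
  "negligible u v \<longleftrightarrow> (\<forall>m. (\<lambda>n. of_nat n ^ m * (u n / v n)) \<longlonglongrightarrow> 0)"

lemma poly_over_power_tendsto:
  fixes p :: "complex poly"
  assumes "degree p \<le> m"
  shows "(\<lambda>n. poly p (of_nat n) / of_nat n ^ m) \<longlonglongrightarrow> coeff p m"
proof -
  have "(\<lambda>n. \<Sum>i\<le>m. coeff p i * (of_nat n ^ i / of_nat n ^ m)) \<longlonglongrightarrow> (\<Sum>i\<le>m. if i = m then coeff p i else 0)"
  proof (rule tendsto_sum)
    fix i assume "i \<in> {..m}"
    then consider "i = m" | "i < m" by force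
    then show "(\<lambda>n. coeff p i * (of_nat n ^ i / of_nat n ^ m)) \<longlonglongrightarrow> (if i = m then coeff p i else 0)"
    proof cases
      case 1
      have "\<forall>\<^sub>F n in sequentially. coeff p i * (of_nat n ^ i / of_nat n ^ m) = coeff p i"
        using eventually_gt_at_top[of "0::nat"] by eventually_elim (simp add: 1)
      then show ?thesis using 1 by (simp add: tendsto_eventually)
    next
      case 2
      have "(\<lambda>n. coeff p i * inverse (of_nat n) ^ (m - i)) \<longlonglongrightarrow> coeff p i * 0 ^ (m - i)"
        by (intro tendsto_intros lim_inverse_n)
      moreover have "\<forall>\<^sub>F n in sequentially. coeff p i * inverse (of_nat n) ^ (m - i) =
                       coeff p i * (of_nat n ^ i / of_nat n ^ m)"
        using eventually_gt_at_top[of "0::nat"] 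
        by eventually_elim (use 2 in \<open>simp add: power_diff power_inverse field_simps\<close>)
      ultimately have "(\<lambda>n. coeff p i * (of_nat n ^ i / of_nat n ^ m)) \<longlonglongrightarrow> coeff p i * 0 ^ (m - i)"
        by (rule Lim_transform_eventually)
      then show ?thesis using 2 by (simp add: power_0_left del: times_divide_eq_right)
    qed
  qed
  moreover have "poly p x / y = (\<Sum>i\<le>m. coeff p i * (x ^ i / y))" for x y
  proof -
    have "poly p x = (\<Sum>i\<le>m. coeff p i * x ^ i)"
      unfolding poly_altdef by (rule sum.mono_neutral_left) (use assms in \<open>auto simp: coeff_eq_0\<close>)
    then show ?thesis by (simp add: sum_divide_distrib)
  qed
  ultimately show ?thesis by simp
qed

lemma negligible_poly_mult:
  assumes "negligible u v"
  shows "(\<lambda>n. poly p (of_nat n) * (u n / v n)) \<longlonglongrightarrow> 0"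
proof -
  have "(\<lambda>n. \<Sum>i\<le>degree p. coeff p i * (of_nat n ^ i * (u n / v n))) \<longlonglongrightarrow> (\<Sum>i\<le>degree p. coeff p i * 0)"
    by (intro tendsto_sum tendsto_mult tendsto_const) (use assms in \<open>simp add: negligible_def\<close>)
  then show ?thesis by (simp add: poly_altdef sum_distrib_right mult.assoc del: times_divide_eq_right)
qed

lemma poly_zero_if_tendsto_0:
  fixes p :: "complex poly"
  assumes "(\<lambda>n. poly p (of_nat n)) \<longlonglongrightarrow> 0"
  shows "p = 0"
proof -
  have "(\<lambda>n. poly p (of_nat n) * inverse (of_nat n) ^ degree p) \<longlonglongrightarrow> 0"
  proof (rule Lim_null_comparison)
    show "\<forall>\<^sub>F n in sequentially. norm (poly p (of_nat n) * inverse (of_nat n) ^ degree p) \<le> norm (poly p (of_nat n))"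
      using eventually_gt_at_top[of "0::nat"]
      by eventually_elim 
        (auto simp: norm_mult norm_power norm_inverse intro!: mult_left_le power_le_one inverse_le_1_iff[THEN iffD2]
           simp del: power_inverse)
    show "(\<lambda>n. norm (poly p (of_nat n))) \<longlonglongrightarrow> 0" using assms tendsto_norm_zero by blast
  qed
  moreover have "(\<lambda>n. poly p (of_nat n) * inverse (of_nat n) ^ degree p) \<longlonglongrightarrow> lead_coeff p"
    using poly_over_power_tendsto[of p "degree p"] by (simp add: field_simps)
  ultimately have "lead_coeff p = 0" using LIMSEQ_unique by blast
  then show ?thesis by simp
qed

text \<open>
  Among the terms with nonzero coefficient take the one on the largest scale and divide by it:
  all other terms tend to zero even with their polynomial factors, hence so does the
  coefficient of the largest one, and a polynomial that tends to zero along the integers is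
  zero. The function \<open>h\<close> ranks the scales, which may be indexed in increasing or decreasing order,
  and \<open>r\<close> leaves room for an error term such as the tail of a series.
\<close>

lemma separated_scales:
  fixes q :: "'i \<Rightarrow> complex poly" and u :: "'i \<Rightarrow> nat \<Rightarrow> complex" and h :: "'i \<Rightarrow> int"
  assumes J: "finite J" and h: "inj_on h J"
    and scale: "\<And>i j. i \<in> J \<Longrightarrow> j \<in> J \<Longrightarrow> h i < h j \<Longrightarrow> negligible (u i) (u j)"
    and nz: "\<And>j. j \<in> J \<Longrightarrow> \<forall>\<^sub>F n in sequentially. u j n \<noteq> 0"
    and rest: "\<And>j. j \<in> J \<Longrightarrow> negligible r (u j)"
    and eq: "\<forall>\<^sub>F n in sequentially. (\<Sum>j\<in>J. poly (q j) (of_nat n) * u j n) + r n = 0"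
    and j: "j \<in> J"
  shows "q j = 0"
proof (rule ccontr)
  assume "q j \<noteq> 0"
  define J' where "J' = {j\<in>J. q j \<noteq> 0}"
  have J': "finite J'" "J' \<noteq> {}" "J' \<subseteq> J" using J j \<open>q j \<noteq> 0\<close> by (auto simp: J'_def)
  obtain t where t: "t \<in> J'" "h t = Max (h ` J')"
    using Max_in[of "h ` J'"] J' by fastforce
  have "t \<in> J" using t J' by auto
  have lt: "h i < h t" if "i \<in> J'" "i \<noteq> t" for i
  proof -
    have "h i \<le> h t" using that t J' by simp
    moreover have "h i \<noteq> h t" using that t h J'(3) by (meson inj_onD subsetD)
    ultimately show ?thesis by simp
  qed
  have "\<forall>\<^sub>F n in sequentially. - ((\<Sum>i\<in>J'-{t}. poly (q i) (of_nat n) * (u i n / u t n)) 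
            + of_nat n ^ 0 * (r n / u t n)) = poly (q t) (of_nat n)"
    using eq nz[OF \<open>t \<in> J\<close>]
  proof eventually_elim
    case (elim n)
    have "(\<Sum>j\<in>J. poly (q j) (of_nat n) * u j n) = (\<Sum>j\<in>J'. poly (q j) (of_nat n) * u j n)"
      using J' J by (intro sum.mono_neutral_right) (auto simp: J'_def)
    also have "\<dots> = poly (q t) (of_nat n) * u t n + (\<Sum>j\<in>J'-{t}. poly (q j) (of_nat n) * u j n)"
      using J' t by (intro sum.remove) auto
    finally have "poly (q t) (of_nat n) * u t n = - ((\<Sum>j\<in>J'-{t}. poly (q j) (of_nat n) * u j n) + r n)"
      using elim(1) by (simp only: eq_neg_iff_add_eq_0 add.assoc)
    then have "poly (q t) (of_nat n) = - ((\<Sum>j\<in>J'-{t}. poly (q j) (of_nat n) * u j n) + r n) / u t n"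
      using elim(2) by (metis nonzero_mult_div_cancel_right)
    then show ?case by (simp add: add_divide_distrib diff_divide_distrib sum_divide_distrib minus_divide_left[symmetric])
  qed
  moreover have "(\<lambda>n. - ((\<Sum>i\<in>J'-{t}. poly (q i) (of_nat n) * (u i n / u t n)) 
            + of_nat n ^ 0 * (r n / u t n))) \<longlonglongrightarrow> - ((\<Sum>i\<in>J'-{t}. 0) + 0)"
  proof (intro tendsto_minus tendsto_add tendsto_sum)
    fix i assume "i \<in> J' - {t}"
    then show "(\<lambda>n. poly (q i) (of_nat n) * (u i n / u t n)) \<longlonglongrightarrow> 0"
      using lt J'(3) \<open>t \<in> J\<close> by (intro negligible_poly_mult scale) auto
  next
    show "(\<lambda>n. of_nat n ^ 0 * (r n / u t n)) \<longlonglongrightarrow> 0"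
      using rest[OF \<open>t \<in> J\<close>] unfolding negligible_def ..
  qed
  ultimately have "(\<lambda>n. poly (q t) (of_nat n)) \<longlonglongrightarrow> - ((\<Sum>i\<in>J'-{t}. 0) + 0)"
    by (rule Lim_transform_eventually[rotated])
  then have "(\<lambda>n. poly (q t) (of_nat n)) \<longlonglongrightarrow> 0" by simp
  then show False using poly_zero_if_tendsto_0 t by (auto simp: J'_def)
qed

lemma power_over_exponential_tendsto_0:
  fixes b :: real
  assumes "b > 1"
  shows "(\<lambda>n. real n ^ k / b ^ n) \<longlonglongrightarrow> 0"
proof -
  have ln: "ln b > 0" using assms by simp
  then have "filterlim (\<lambda>n. real n * ln b) at_top sequentially"
    by (intro filterlim_at_top_mult_tendsto_pos[OF tendsto_const _ filterlim_real_sequentially])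
  from filterlim_compose[OF tendsto_power_div_exp_0 this]
  have "(\<lambda>n. (real n * ln b) ^ k / exp (real n * ln b) / ln b ^ k) \<longlonglongrightarrow> 0 / ln b ^ k"
    using ln by (intro tendsto_divide) auto
  then show ?thesis using ln assms by (simp add: power_mult_distrib exp_of_nat_mult)
qed

lemma power_over_fact_tendsto_0: "(\<lambda>n. real n ^ k / fact n) \<longlonglongrightarrow> 0"
proof -
  have "(\<lambda>n. 2 ^ n / fact n :: real) \<longlonglongrightarrow> 0"
    using summable_LIMSEQ_zero[OF summable_exp[of "2::real"]] by (simp add: field_simps)
  from tendsto_mult[OF power_over_exponential_tendsto_0[of 2 k] this] show ?thesis by simp
qed

lemma negligible_0: "negligible (\<lambda>_. 0) u"
  by (simp add: negligible_def)

text \<open>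
  All coefficients of a recurrence have to be shown to vanish, not only \<open>p 0\<close>: the arguments below
  concern the terms that dominate, and these may belong to any of the shifts.
\<close>

lemma not_holonomic_fromI:
  assumes "\<And>d p. \<forall>\<^sub>F n in sequentially. (\<Sum>k\<le>d. poly (p k) (of_nat n) * f (n - k)) = 0 \<Longrightarrow>
             \<forall>k\<le>d. p k = 0"
  shows "\<not> holonomic_from m f"
proof
  assume "holonomic_from m f"
  then obtain d p where p: "p 0 \<noteq> 0" "\<forall>n\<ge>m + d. (\<Sum>k\<le>d. poly (p k) (of_nat n) * f (n - k)) = 0"
    unfolding holonomic_from_def by blast
  have "\<forall>\<^sub>F n in sequentially. (\<Sum>k\<le>d. poly (p k) (of_nat n) * f (n - k)) = 0"
    using eventually_ge_at_top[of "m + d"] by eventually_elim (use p(2) in blast)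
  from assms[OF this] p(1) show False by blast
qed

lemma holonomic_from_cong:
  assumes "\<And>n. n \<ge> m \<Longrightarrow> f n = g n"
  shows "holonomic_from m f \<longleftrightarrow> holonomic_from m g"
proof -
  have "(\<Sum>k\<le>d. poly (p k) (of_nat n) * f (n - k)) = (\<Sum>k\<le>d. poly (p k) (of_nat n) * g (n - k))"
    if "n \<ge> m + d" for n d and p :: "nat \<Rightarrow> complex poly"
    by (rule sum.cong) (use assms that in auto)
  then show ?thesis unfolding holonomic_from_def by (simp cong: conj_cong)
qed


lemma negligible_poly_times:
  assumes "negligible v u"
  shows "negligible (\<lambda>n. poly q (of_nat n) * v n) u"
  unfolding negligible_def
proof
  fix l
  have "(\<lambda>n. poly (monom 1 l * q) (of_nat n) * (v n / u n)) \<longlonglongrightarrow> 0"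
    by (rule negligible_poly_mult[OF assms])
  then show "(\<lambda>n. of_nat n ^ l * (poly q (of_nat n) * v n / u n)) \<longlonglongrightarrow> 0"
    by (simp add: poly_monom mult.assoc)
qed

lemma negligible_sum:
  assumes "\<And>i. i \<in> I \<Longrightarrow> negligible (v i) u"
  shows "negligible (\<lambda>n. \<Sum>i\<in>I. v i n) u"
  unfolding negligible_def
proof
  fix l
  have "(\<lambda>n. \<Sum>i\<in>I. of_nat n ^ l * (v i n / u n)) \<longlonglongrightarrow> (\<Sum>i\<in>I. 0)"
    by (rule tendsto_sum) (use assms in \<open>auto simp: negligible_def\<close>)
  then show "(\<lambda>n. of_nat n ^ l * ((\<Sum>i\<in>I. v i n) / u n)) \<longlonglongrightarrow> 0"
    by (simp add: sum_divide_distrib sum_distrib_left)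
qed

lemma negligible_mono:
  assumes "negligible w u" and le: "\<forall>\<^sub>F n in sequentially. norm (v n) \<le> C * norm (w n)"
  shows "negligible v u"
  unfolding negligible_def
proof
  fix l
  have "(\<lambda>n. C * norm (of_nat n ^ l * (w n / u n))) \<longlonglongrightarrow> C * norm (0::complex)"
    using assms(1) unfolding negligible_def by (intro tendsto_intros) blast
  then have lim: "(\<lambda>n. C * norm (of_nat n ^ l * (w n / u n))) \<longlonglongrightarrow> 0" by simp
  show "(\<lambda>n. of_nat n ^ l * (v n / u n)) \<longlonglongrightarrow> 0"
  proof (rule Lim_null_comparison[OF _ lim])
    show "\<forall>\<^sub>F n in sequentially. norm (of_nat n ^ l * (v n / u n)) \<le> C * norm (of_nat n ^ l * (w n / u n))"
      using le
    proof eventually_elim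
      case (elim n)
      have "real n ^ l * (norm (v n) / norm (u n)) \<le> real n ^ l * (C * norm (w n) / norm (u n))"
        using elim by (intro mult_left_mono divide_right_mono) auto
      then show ?case by (simp add: norm_mult norm_divide norm_power mult_ac)
    qed
  qed
qed

lemma negligible_exponentials:
  assumes "0 < j" "j < i"
  shows "negligible (\<lambda>n. 1 / of_nat i ^ n) (\<lambda>n. 1 / of_nat j ^ n)"
  unfolding negligible_def
proof
  fix l
  have "(\<lambda>n. of_real (real n ^ l / (real i / real j) ^ n) :: complex) \<longlonglongrightarrow> of_real 0"
    using assms by (intro tendsto_of_real power_over_exponential_tendsto_0) simp
  then show "(\<lambda>n. of_nat n ^ l * (1 / of_nat i ^ n / (1 / of_nat j ^ n)) :: complex) \<longlonglongrightarrow> 0"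
    by (simp add: power_divide)
qed

section \<open>Reciprocals of powers of two and of factorials\<close>

text \<open>
  The powers of a sequence that grows faster than every power of \<open>n\<close> lie on separated scales. Hence such
  a sequence is algebraically independent of \<open>n\<close>. The outer variable of \<open>Q\<close> stands for
  \<open>u n\<close>, the inner one for \<open>n\<close>.
\<close>

lemma poly_in_large_sequence_zero:
  fixes Q :: "complex poly poly" and u :: "nat \<Rightarrow> complex"
  assumes u: "negligible (\<lambda>_. 1) u" and nz: "\<forall>\<^sub>F n in sequentially. u n \<noteq> 0"
    and eq: "\<forall>\<^sub>F n in sequentially. poly (poly Q [:u n:]) (of_nat n) = 0"
  shows "Q = 0"
proof (rule poly_eqI)
  fix j
  have pow: "negligible (\<lambda>n. u n ^ i) (\<lambda>n. u n ^ k)" if "i < k" for i k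
    unfolding negligible_def
  proof
    fix m
    have "(\<lambda>n. of_nat n ^ m * (1 / u n) * (of_nat n ^ 0 * (1 / u n)) ^ (k - i - 1)) \<longlonglongrightarrow> 0 * 0 ^ (k - i - 1)"
      using u unfolding negligible_def by (intro tendsto_mult tendsto_power) blast+
    moreover have "\<forall>\<^sub>F n in sequentially. of_nat n ^ m * (1 / u n) * (of_nat n ^ 0 * (1 / u n)) ^ (k - i - 1)
                 = of_nat n ^ m * (u n ^ i / u n ^ k)"
      using nz
    proof eventually_elim
      case (elim n)
      have "k = i + 1 + (k - i - 1)" using that by simp
      then have "u n ^ k = u n ^ i * u n * u n ^ (k - i - 1)"
        by (metis power_add power_one_right)
      then show ?case using elim by (simp add: power_one_over)
    qed
    ultimately have "(\<lambda>n. of_nat n ^ m * (u n ^ i / u n ^ k)) \<longlonglongrightarrow> 0 * 0 ^ (k - i - 1)"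
      by (rule Lim_transform_eventually)
    then show "(\<lambda>n. of_nat n ^ m * (u n ^ i / u n ^ k)) \<longlonglongrightarrow> 0" by (simp only: mult_zero_left)
  qed
  show "coeff Q j = coeff 0 j"
  proof (cases "j \<le> degree Q")
    case True
    have "coeff Q j = 0"
    proof (rule separated_scales[of "{..degree Q}" int "\<lambda>j n. u n ^ j" "\<lambda>_. 0" "coeff Q"])
      have "poly (poly Q [:u n:]) (of_nat n) = (\<Sum>j\<le>degree Q. poly (coeff Q j) (of_nat n) * u n ^ j)" for n
        by (simp add: poly_altdef[of Q] poly_sum)
      with eq show "\<forall>\<^sub>F n in sequentially. (\<Sum>j\<le>degree Q. poly (coeff Q j) (of_nat n) * u n ^ j) + 0 = 0"
        by simp
    next
      show "\<forall>\<^sub>F n in sequentially. u n ^ i \<noteq> 0" for i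
        using nz by eventually_elim simp
    qed (use True pow in \<open>auto simp: negligible_0\<close>)
    then show ?thesis by simp
  qed (simp add: coeff_eq_0)
qed

text \<open>
  The hypothesis says that \<open>f (n - k) = b\<^sub>k (n) / (u n + a\<^sub>k (n))\<close>. Multiplying a recurrence by all
  denominators gives a polynomial relation between \<open>n\<close> and \<open>u n\<close>, which must be an identity. Setting
  the variable for \<open>u n\<close> equal to \<open>- a\<^sub>k\<close> kills all summands except the one with index \<open>k\<close>, because
  the \<open>a\<^sub>k\<close> are distinct.
\<close>

lemma not_holonomic_shifted_reciprocals:
  fixes f u :: "nat \<Rightarrow> complex" and a b :: "nat \<Rightarrow> complex poly"
  assumes u: "negligible (\<lambda>_. 1) u" "\<forall>\<^sub>F n in sequentially. u n \<noteq> 0"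
    and a: "inj a" and b: "\<And>k. b k \<noteq> 0"
    and f: "\<And>k. \<forall>\<^sub>F n in sequentially. f (n - k) * (u n + poly (a k) (of_nat n)) = poly (b k) (of_nat n)"
  shows "\<not> holonomic_from m f"
proof (rule not_holonomic_fromI)
  fix d :: nat and p :: "nat \<Rightarrow> complex poly"
  assume rec: "\<forall>\<^sub>F n in sequentially. (\<Sum>k\<le>d. poly (p k) (of_nat n) * f (n - k)) = 0"
  define Q where "Q = (\<Sum>k\<le>d. [:p k * b k:] * (\<Prod>j\<in>{..d}-{k}. [:a j, 1:]))"
  have "\<forall>\<^sub>F n in sequentially. \<forall>k\<in>{..d}. f (n - k) * (u n + poly (a k) (of_nat n)) = poly (b k) (of_nat n)"
    by (rule eventually_ball_finite) (use f in auto)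
  with rec have "\<forall>\<^sub>F n in sequentially. poly (poly Q [:u n:]) (of_nat n) = 0"
  proof eventually_elim
    case (elim n)
    have "poly (poly Q [:u n:]) (of_nat n) =
       (\<Sum>k\<le>d. poly (p k) (of_nat n) * poly (b k) (of_nat n) * (\<Prod>j\<in>{..d}-{k}. u n + poly (a j) (of_nat n)))"
      by (simp add: Q_def poly_sum poly_prod add.commute)
    also have "\<dots> = (\<Sum>k\<le>d. poly (p k) (of_nat n) * f (n - k) * (\<Prod>j\<le>d. u n + poly (a j) (of_nat n)))"
    proof (rule sum.cong[OF refl])
      fix k assume k: "k \<in> {..d}"
      have "(\<Prod>j\<le>d. u n + poly (a j) (of_nat n)) 
              = (u n + poly (a k) (of_nat n)) * (\<Prod>j\<in>{..d}-{k}. u n + poly (a j) (of_nat n))"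
        using k by (intro prod.remove) auto
      then show "poly (p k) (of_nat n) * poly (b k) (of_nat n) * (\<Prod>j\<in>{..d}-{k}. u n + poly (a j) (of_nat n))
        = poly (p k) (of_nat n) * f (n - k) * (\<Prod>j\<le>d. u n + poly (a j) (of_nat n))"
        using elim(2)[rule_format, OF k, symmetric] by simp
    qed
    also have "\<dots> = 0" using elim(1) by (simp flip: sum_distrib_right)
    finally show ?case .
  qed
  then have "Q = 0" using poly_in_large_sequence_zero u by blast
  show "\<forall>k\<le>d. p k = 0"
  proof (intro allI impI)
    fix k assume k: "k \<le> d"
    \<comment> \<open>Every product over \<open>j \<noteq> i\<close> with \<open>i \<noteq> k\<close> contains the vanishing factor with \<open>j = k\<close>.\<close>
    have "0 = poly Q (- a k)" using \<open>Q = 0\<close> by simp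
    also have "\<dots> = (\<Sum>i\<le>d. p i * b i * (\<Prod>j\<in>{..d}-{i}. a j - a k))"
      by (simp add: Q_def poly_sum poly_prod)
    also have "\<dots> = (\<Sum>i\<in>{k}. p i * b i * (\<Prod>j\<in>{..d}-{i}. a j - a k))"
      by (rule sum.mono_neutral_right) (use k in \<open>auto simp: prod_zero_iff\<close>)
    finally have "p k * b k * (\<Prod>j\<in>{..d}-{k}. a j - a k) = 0" by simp
    then show "p k = 0" using b a by (auto simp: inj_def)
  qed
qed

text \<open>
  Multiply numerator and denominator of \<open>1 / (2 ^ (n - k) + \<epsilon>)\<close> by \<open>2 ^ k\<close>.
\<close>

lemma not_holonomic_reciprocal_power_of_2:
  assumes "\<epsilon> \<in> {1, -1}"
  shows "\<not> holonomic_from m (\<lambda>n. 1 / (2 ^ n + \<epsilon>) :: complex)"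
proof (rule not_holonomic_shifted_reciprocals[of "\<lambda>n. 2 ^ n" "\<lambda>k. [:\<epsilon> * 2 ^ k:]" "\<lambda>k. [:2 ^ k:]"])
  show "negligible (\<lambda>_. 1) (\<lambda>n. 2 ^ n)"
    unfolding negligible_def
  proof
    fix k
    have "(\<lambda>n. of_real (real n ^ k / 2 ^ n) :: complex) \<longlonglongrightarrow> of_real 0"
      by (intro tendsto_of_real power_over_exponential_tendsto_0) simp
    then show "(\<lambda>n. of_nat n ^ k * (1 / 2 ^ n) :: complex) \<longlonglongrightarrow> 0" by simp
  qed
  show "inj (\<lambda>k. [:\<epsilon> * 2 ^ k:])"
  proof (rule injI)
    fix i j :: nat assume "[:\<epsilon> * 2 ^ i:] = [:\<epsilon> * 2 ^ j:]"
    then have "\<epsilon> * 2 ^ i = \<epsilon> * 2 ^ j" by simp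
    then have "(2::complex) ^ i = 2 ^ j" using assms by (elim insertE) auto
    then have "(2::nat) ^ i = 2 ^ j" by (metis of_nat_eq_iff of_nat_numeral of_nat_power)
    then show "i = j" by simp
  qed
  fix k
  show "\<forall>\<^sub>F n in sequentially. 1 / (2 ^ (n - k) + \<epsilon>) * (2 ^ n + poly [:\<epsilon> * 2 ^ k:] (of_nat n)) = poly [:2 ^ k:] (of_nat n)"
    using eventually_gt_at_top[of k]
  proof eventually_elim
    case (elim n)
    have 2: "(2::complex) ^ n = 2 ^ k * 2 ^ (n - k)" using elim by (simp flip: power_add)
    have "(2::nat) ^ (n - k) \<noteq> 1" using elim by simp
    then have "(2::complex) ^ (n - k) \<noteq> 1" by (metis of_nat_eq_iff of_nat_numeral of_nat_power of_nat_1)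
    moreover have "(2::nat) ^ (n - k) + 1 \<noteq> 0" by simp
    then have "(2::complex) ^ (n - k) \<noteq> -1" 
      by (metis add_eq_0_iff2 of_nat_0 of_nat_1 of_nat_add of_nat_eq_0_iff of_nat_numeral of_nat_power)
    ultimately have "2 ^ (n - k) + \<epsilon> \<noteq> 0" using assms by (auto simp: add_eq_0_iff2)
    then show ?case by (simp add: 2 field_simps)
  qed
qed auto

text \<open>
  Here \<open>ff k\<close> is the falling factorial \<open>x (x - 1) \<dots> (x - k + 1)\<close>, which expresses \<open>(n - k)!\<close> through \<open>n!\<close>;
  its degree \<open>k\<close> makes these polynomials distinct.
\<close>

lemma not_holonomic_reciprocal_fact_plus_1:
  "\<not> holonomic_from m (\<lambda>n. 1 / (fact n + 1) :: complex)"
proof -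
  define ff :: "nat \<Rightarrow> complex poly" where "ff = (\<lambda>k. \<Prod>i<k. [:- of_nat i, 1:])"
  have deg: "degree (ff k) = k" for k
    unfolding ff_def by (simp add: degree_prod_eq_sum_degree)
  have nz: "ff k \<noteq> 0" for k by (simp add: ff_def)
  have fact: "fact n = poly (ff k) (of_nat n) * fact (n - k)" if "k \<le> n" for n k
    using that
  proof (induction k)
    case (Suc k)
    have "fact (n - k) = (of_nat n - of_nat k) * (fact (n - Suc k) :: complex)"
    proof -
      have "n - k = Suc (n - Suc k)" using Suc.prems by simp
      then have "fact (n - k) = of_nat (n - k) * (fact (n - Suc k) :: complex)"
        by (metis fact_Suc)
      then show ?thesis using Suc.prems by (simp only: of_nat_diff Suc_leD)
    qed
    then show ?case using Suc by (simp add: ff_def) (simp add: ring_distribs mult.assoc mult.left_commute)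
  qed (simp add: ff_def)
  show ?thesis
  proof (rule not_holonomic_shifted_reciprocals[of "fact" ff ff])
    show "negligible (\<lambda>_. 1) fact"
      unfolding negligible_def
    proof
      fix k
      have "(\<lambda>n. of_real (real n ^ k / fact n) :: complex) \<longlonglongrightarrow> of_real 0"
        by (intro tendsto_of_real power_over_fact_tendsto_0)
      then show "(\<lambda>n. of_nat n ^ k * (1 / fact n) :: complex) \<longlonglongrightarrow> 0" by simp
    qed
    show "inj ff" using deg by (metis injI)
    fix k
    show "\<forall>\<^sub>F n in sequentially. 1 / (fact (n - k) + 1) * (fact n + poly (ff k) (of_nat n)) = poly (ff k) (of_nat n)"
      using eventually_ge_at_top[of k]
    proof eventually_elim
      case (elim n)
      have "fact (n - k) + (1::complex) \<noteq> 0"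
        by (metis of_nat_fact of_nat_Suc add.commute of_nat_neq_0)
      moreover have "fact n + poly (ff k) (of_nat n) = poly (ff k) (of_nat n) * (fact (n - k) + 1)"
        using fact[OF elim] by (simp add: ring_distribs)
      ultimately show ?case by simp
    qed
  qed (use nz in auto)
qed

section \<open>Dirichlet series and the reciprocal of the zeta function\<close>

text \<open>
  The hypothesis \<open>a 0 = 0\<close> excludes the index \<open>0\<close> from the series; for \<open>n = 0\<close> the term with that index
  would otherwise be \<open>a 0\<close>.
\<close>

lemma dirichlet_tail_bound:
  fixes a :: "nat \<Rightarrow> complex"
  assumes a: "summable (\<lambda>j. norm (a j))" "a 0 = 0"
  shows "norm ((\<Sum>j. a j / of_nat j ^ n) - (\<Sum>j\<in>{1..M}. a j / of_nat j ^ n))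
           \<le> (\<Sum>j. norm (a j)) / real (Suc M) ^ n"
proof -
  define b where "b = (\<lambda>j. if j \<le> M then 0 else a j / of_nat j ^ n)"
  have le1: "norm (a j / of_nat j ^ n) \<le> norm (a j)" for j
  proof (cases "j = 0")
    case False
    then have "real j ^ n \<ge> 1" by (intro one_le_power) simp
    then show ?thesis using mult_left_mono[of 1 "real j ^ n" "norm (a j)"] False
      by (simp add: norm_divide norm_power divide_le_eq)
  qed (simp add: a)
  have sm: "summable (\<lambda>j. a j / of_nat j ^ n)"
    by (rule summable_comparison_test'[OF a(1), of 0]) (use le1 in auto)
  have b_le: "norm (b j) \<le> norm (a j) / real (Suc M) ^ n" for j
    unfolding b_def by (auto simp: norm_divide norm_power intro!: divide_left_mono power_mono mult_pos_pos)
  have sums: "summable (\<lambda>j. norm (a j) / real (Suc M) ^ n)" using a(1) by (rule summable_divide)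
  have "(\<Sum>j. a j / of_nat j ^ n) = (\<Sum>j. (if j \<in> {..M} then a j / of_nat j ^ n else 0) + b j)"
    by (rule suminf_cong) (auto simp: b_def)
  also have "\<dots> = (\<Sum>j. if j \<in> {..M} then a j / of_nat j ^ n else 0) + (\<Sum>j. b j)"
  proof (rule suminf_add[symmetric])
    show "summable b"
      by (rule summable_comparison_test'[OF sums, of 0]) (use b_le in auto)
  qed (rule summable_If_finite_set, simp)
  also have "(\<Sum>j. if j \<in> {..M} then a j / of_nat j ^ n else 0) = (\<Sum>j\<in>{..M}. a j / of_nat j ^ n)"
    by (rule sums_unique[symmetric, OF sums_If_finite_set]) simp
  also have "\<dots> = (\<Sum>j\<in>{1..M}. a j / of_nat j ^ n)"
    by (rule sum.mono_neutral_right) (auto simp: a not_less_eq_eq)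
  finally have "(\<Sum>j. a j / of_nat j ^ n) - (\<Sum>j\<in>{1..M}. a j / of_nat j ^ n) = (\<Sum>j. b j)" by simp
  also have "norm \<dots> \<le> (\<Sum>j. norm (a j) / real (Suc M) ^ n)"
    by (rule norm_suminf_le[OF b_le sums])
  also have "\<dots> = (\<Sum>j. norm (a j)) / real (Suc M) ^ n" using a(1) by (rule suminf_divide)
  finally show ?thesis .
qed

text \<open>
  Truncate the series at an index \<open>M\<close> with \<open>a M \<noteq> 0\<close>. The terms \<open>j\<^sup>-\<^sup>n\<close> with \<open>j \<le> M\<close> lie on separated
  scales and the tail is of order \<open>(M + 1)\<^sup>-\<^sup>n\<close>, so in a recurrence the total coefficient of
  \<open>M\<^sup>-\<^sup>n\<close> is zero. Since the shift by \<open>k\<close> multiplies the coefficient of \<open>M\<^sup>-\<^sup>n\<close> by \<open>M ^ k\<close>, this makes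
  \<open>M\<close> a root of the polynomial \<open>Q = \<Sum>k. p\<^sub>k X\<^sup>k\<close>, and there are infinitely many such \<open>M\<close>.
\<close>

lemma not_holonomic_dirichlet_series:
  fixes a :: "nat \<Rightarrow> complex"
  assumes a: "summable (\<lambda>j. norm (a j))" "a 0 = 0" and inf: "infinite {j. a j \<noteq> 0}"
  shows "\<not> holonomic_from m (\<lambda>n. \<Sum>j. a j / of_nat j ^ n)"
proof (rule not_holonomic_fromI)
  fix d :: nat and p :: "nat \<Rightarrow> complex poly"
  let ?f = "\<lambda>n. \<Sum>j. a j / of_nat j ^ n"
  assume rec: "\<forall>\<^sub>F n in sequentially. (\<Sum>k\<le>d. poly (p k) (of_nat n) * ?f (n - k)) = 0"
  define Q where "Q = (\<Sum>k\<le>d. monom (p k) k)"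
  have root: "poly Q [:of_nat M:] = 0" if M: "a M \<noteq> 0" for M
  proof -
    have "M > 0" using M a(2) by (cases M) auto
    define R where "R = (\<lambda>k n. ?f (n - k) - (\<Sum>j\<in>{1..M}. a j / of_nat j ^ (n - k)))"
    define q where "q = (\<lambda>j. smult (a j) (poly Q [:of_nat j:]))"
    have Qj: "poly Q [:of_nat j:] = (\<Sum>k\<le>d. smult (of_nat j ^ k) (p k))" for j
      by (simp add: Q_def poly_sum poly_monom poly_const_pow mult.commute)
    have "q M = 0"
    proof (rule separated_scales[of "{1..M}" "\<lambda>j. - int j" "\<lambda>j n. 1 / of_nat j ^ n"
           "\<lambda>n. \<Sum>k\<le>d. poly (p k) (of_nat n) * R k n" q])
      fix j assume j: "j \<in> {1..M}"
      have "negligible (R k) (\<lambda>n. 1 / of_nat j ^ n)" for k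
      proof (rule negligible_mono)
        show "negligible (\<lambda>n. 1 / of_nat (Suc M) ^ n) (\<lambda>n. 1 / of_nat j ^ n)"
          by (rule negligible_exponentials) (use j in auto)
        show "\<forall>\<^sub>F n in sequentially. norm (R k n) \<le>
                (\<Sum>j. norm (a j)) * real (Suc M) ^ k * norm (1 / of_nat (Suc M) ^ n :: complex)"
          using eventually_ge_at_top[of k]
        proof eventually_elim
          case (elim n)
          have "real (Suc M) ^ n = real (Suc M) ^ k * real (Suc M) ^ (n - k)"
            using elim by (simp flip: power_add)
          then show ?case
            using dirichlet_tail_bound[OF a, of "n - k" M]
            by (simp add: R_def norm_divide norm_power del: of_nat_Suc)
        qed
      qed
      then show "negligible (\<lambda>n. \<Sum>k\<le>d. poly (p k) (of_nat n) * R k n) (\<lambda>n. 1 / of_nat j ^ n)"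
        by (intro negligible_sum negligible_poly_times)
    next
      show "\<forall>\<^sub>F n in sequentially. (\<Sum>j\<in>{1..M}. poly (q j) (of_nat n) * (1 / of_nat j ^ n)) +
               (\<Sum>k\<le>d. poly (p k) (of_nat n) * R k n) = 0"
        using rec eventually_ge_at_top[of d]
      proof eventually_elim
        case (elim n)
        have "(\<Sum>j\<in>{1..M}. poly (q j) (of_nat n) * (1 / of_nat j ^ n)) =
              (\<Sum>j\<in>{1..M}. \<Sum>k\<le>d. poly (p k) (of_nat n) * (a j / of_nat j ^ (n - k)))"
        proof (rule sum.cong[OF refl])
          fix j assume j: "j \<in> {1..M}"
          have "poly (q j) (of_nat n) * (1 / of_nat j ^ n) =
                (\<Sum>k\<le>d. poly (p k) (of_nat n) * (a j * (of_nat j ^ k / of_nat j ^ n)))"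
            by (simp add: q_def Qj poly_sum sum_distrib_left sum_distrib_right sum_divide_distrib mult_ac)
          also have "\<dots> = (\<Sum>k\<le>d. poly (p k) (of_nat n) * (a j / of_nat j ^ (n - k)))"
            by (rule sum.cong[OF refl]) (use elim j in \<open>simp add: power_diff\<close>)
          finally show "poly (q j) (of_nat n) * (1 / of_nat j ^ n) =
             (\<Sum>k\<le>d. poly (p k) (of_nat n) * (a j / of_nat j ^ (n - k)))" .
        qed
        also have "\<dots> = (\<Sum>k\<le>d. poly (p k) (of_nat n) * (\<Sum>j\<in>{1..M}. a j / of_nat j ^ (n - k)))"
          by (subst sum.swap) (simp add: sum_distrib_left)
        also have "\<dots> + (\<Sum>k\<le>d. poly (p k) (of_nat n) * R k n) = (\<Sum>k\<le>d. poly (p k) (of_nat n) * ?f (n - k))"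
          by (simp add: R_def sum.distrib[symmetric] ring_distribs[symmetric])
        finally show ?case using elim by simp
      qed
    next
      fix i j assume "i \<in> {1..M}" "j \<in> {1..M}" "- int i < - int j"
      then show "negligible (\<lambda>n. 1 / of_nat i ^ n) (\<lambda>n. 1 / of_nat j ^ n)"
        by (intro negligible_exponentials) auto
    qed (use \<open>M > 0\<close> in \<open>auto simp: inj_on_def\<close>)
    then show ?thesis using M by (simp add: q_def)
  qed
  have "Q = 0"
  proof (rule ccontr)
    assume "Q \<noteq> 0"
    then have "finite {x. poly Q x = 0}" by (rule poly_roots_finite)
    moreover have "(\<lambda>M. [:of_nat M:]) ` {j. a j \<noteq> 0} \<subseteq> {x. poly Q x = 0}" using root by blast
    ultimately have "finite ((\<lambda>M. [:of_nat M :: complex:]) ` {j. a j \<noteq> 0})" by (rule finite_subset[rotated])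
    then have "finite {j. a j \<noteq> 0}" by (rule finite_imageD) (simp add: inj_on_def)
    then show False using inf by contradiction
  qed
  show "\<forall>k\<le>d. p k = 0"
  proof (intro allI impI)
    fix k assume "k \<le> d"
    then have "coeff Q k = p k" by (simp add: Q_def coeff_sum)
    then show "p k = 0" using \<open>Q = 0\<close> by simp
  qed
qed

definition moebius_mu :: "nat \<Rightarrow> complex" where
  "moebius_mu n = (if squarefree n then (-1) ^ card (prime_factors n) else 0)"

text \<open>
  For a prime \<open>p\<close> dividing \<open>n\<close>, multiplication by \<open>p\<close> pairs the squarefree divisors of \<open>n\<close> that are prime to
  \<open>p\<close> with those that are divisible by \<open>p\<close>, and it changes the sign of the Moebius function.
\<close>

lemma sum_moebius_mu_divisors:
  assumes "n > 1"
  shows "(\<Sum>d | d dvd n. moebius_mu d) = 0"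
proof -
  obtain p where p: "prime p" "p dvd n" using assms prime_factor_nat[of n] by auto
  define A where "A = {d. d dvd n \<and> squarefree d \<and> \<not> p dvd d}"
  define B where "B = {d. d dvd n \<and> squarefree d \<and> p dvd d}"
  have fin: "finite {d. d dvd n}" using assms by simp
  have AB: "finite A" "finite B" "A \<inter> B = {}" 
    using fin by (auto simp: A_def B_def intro: finite_subset[OF _ fin])
  have "(\<Sum>d | d dvd n. moebius_mu d) = (\<Sum>d\<in>A \<union> B. moebius_mu d)"
    by (rule sum.mono_neutral_right[OF fin]) (auto simp: A_def B_def moebius_mu_def)
  also have "\<dots> = (\<Sum>d\<in>A. moebius_mu d) + (\<Sum>d\<in>B. moebius_mu d)" using AB by (rule sum.union_disjoint)
  also have "(\<Sum>d\<in>B. moebius_mu d) = (\<Sum>d\<in>A. - moebius_mu d)"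
  proof (rule sum.reindex_bij_witness[of _ "\<lambda>d. p * d" "\<lambda>d. d div p"])
    fix e assume e: "e \<in> B"
    then obtain d where d: "e = p * d" by (auto simp: B_def)
    have pd: "\<not> p dvd d"
    proof
      assume "p dvd d"
      then have "p ^ 2 dvd e" by (simp add: d power2_eq_square)
      then have "p dvd 1" using e squarefreeD[of e p] by (simp add: B_def)
      then show False using p(1) by simp
    qed
    then show A: "e div p \<in> A"
      using e p by (auto simp: d A_def B_def intro: dvd_mult_right dest: squarefree_multD)
    show "p * (e div p) = e" using p d by auto
    have nz: "d \<noteq> 0" using pd by (cases d) auto
    have "prime_factors (p * d) = insert p (prime_factors d)"
      using p nz by (subst prime_factors_product) (auto simp: prime_prime_factors)
    moreover have "p \<notin> prime_factors d" using pd by auto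
    ultimately show "- moebius_mu (e div p) = moebius_mu e"
      using A e p by (auto simp: d moebius_mu_def A_def B_def)
  next
    fix d assume d: "d \<in> A"
    show "(p * d) div p = d" using p by auto
    have cop: "coprime p d" using d p by (auto simp: A_def prime_imp_coprime)
    then show "p * d \<in> B"
      using d p by (auto simp: A_def B_def intro: divides_mult squarefree_mult_coprime squarefree_prime)
  qed
  finally show ?thesis by (simp add: sum_negf)
qed

lemma norm_moebius_mu_le_1: "norm (moebius_mu n) \<le> 1"
  by (simp add: moebius_mu_def norm_power)

text \<open>
  Expand \<open>W * Z\<close> as an absolutely convergent double series over the pairs \<open>(j, k)\<close> and group the pairs by
  their product \<open>N = j k\<close>. By \<open>sum_moebius_mu_divisors\<close> only the group \<open>N = 1\<close> contributes.
\<close>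

lemma moebius_mu_dirichlet_inverse:
  assumes Z: "((\<lambda>k. 1 / of_nat k ^ s) has_sum Z) {1..}"
    and W: "((\<lambda>j. moebius_mu j / of_nat j ^ s) has_sum W) {1..}"
    and Zn: "(\<lambda>k. norm (1 / of_nat k ^ s :: complex)) summable_on {1..}"
    and Wn: "(\<lambda>j. norm (moebius_mu j / of_nat j ^ s)) summable_on {1..}"
  shows "W * Z = 1"
proof -
  define f where "f = (\<lambda>(j, k). moebius_mu j / of_nat j ^ s * (1 / of_nat k ^ s :: complex))"
  have sum: "f summable_on {1..} \<times> {1..}"
  proof (rule abs_summable_summable)
    obtain Z' where Z': "((\<lambda>k. norm (1 / of_nat k ^ s :: complex)) has_sum Z') {1..}"
      using Zn by (auto simp: summable_on_def)
    show "(\<lambda>x. norm (f x)) summable_on {1..} \<times> {1..}"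
    proof (rule summable_on_SigmaI)
      fix j :: nat
      show "((\<lambda>k. norm (f (j, k))) has_sum norm (moebius_mu j / of_nat j ^ s) * Z') {1..}"
        using has_sum_cmult_right[OF Z', of "norm (moebius_mu j / of_nat j ^ s)"]
        by (simp add: f_def norm_mult norm_divide)
    qed (use summable_on_cmult_left[OF Wn, of Z'] in auto)
  qed
  have "(f has_sum W * Z) ({1..} \<times> {1..})"
  proof (rule has_sum_SigmaI[OF _ _ sum])
    show "((\<lambda>k. f (j, k)) has_sum moebius_mu j / of_nat j ^ s * Z) {1..}" for j
      using has_sum_cmult_right[OF Z, of "moebius_mu j / of_nat j ^ s"] by (simp add: f_def)
    show "((\<lambda>j. moebius_mu j / of_nat j ^ s * Z) has_sum W * Z) {1..}"
      using has_sum_cmult_left[OF W, of Z] by simp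
  qed
  moreover have bij: "bij_betw (\<lambda>(N, j). (j, N div j)) (SIGMA N:{1..}. {j. j dvd N}) ({1..} \<times> {1::nat..})"
  proof (rule bij_betwI[where g = "\<lambda>(j, k). (j * k, j)"])
    show "(\<lambda>(N, j). (j, N div j)) \<in> (SIGMA N:{1..}. {j. j dvd N}) \<rightarrow> {1..} \<times> {1::nat..}"
      by (auto elim!: dvdE)
    show "(\<lambda>(j, k). (j * k, j)) \<in> {1..} \<times> {1::nat..} \<rightarrow> (SIGMA N:{1..}. {j. j dvd N})"
      by auto
  qed (auto elim!: dvdE)
  ultimately have "((\<lambda>x. f ((\<lambda>(N, j). (j, N div j)) x)) has_sum W * Z) (SIGMA N:{1..}. {j. j dvd N})"
    by (subst has_sum_reindex_bij_betw[OF bij])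
  then have "((\<lambda>N. \<Sum>j | j dvd N. moebius_mu j / of_nat N ^ s) has_sum W * Z) {1..}"
  proof (rule has_sum_SigmaD)
    fix N :: nat assume N: "N \<in> {1..}"
    have "((\<lambda>j. moebius_mu j / of_nat N ^ s) has_sum (\<Sum>j | j dvd N. moebius_mu j / of_nat N ^ s)) {j. j dvd N}"
      using N by (intro has_sum_finite) auto
    also have "?this \<longleftrightarrow> ((\<lambda>j. f ((\<lambda>(N, j). (j, N div j)) (N, j))) has_sum 
                  (\<Sum>j | j dvd N. moebius_mu j / of_nat N ^ s)) {j. j dvd N}"
      by (rule has_sum_cong) (auto simp: f_def power_mult_distrib elim!: dvdE)
    finally show "((\<lambda>j. f ((\<lambda>(N, j). (j, N div j)) (N, j))) has_sum 
                  (\<Sum>j | j dvd N. moebius_mu j / of_nat N ^ s)) {j. j dvd N}" .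
  qed
  also have "?this \<longleftrightarrow> ((\<lambda>_. 1) has_sum W * Z) {1::nat}"
  proof (rule has_sum_cong_neutral)
    fix N :: nat assume "N \<in> {1..} - {1}"
    then show "(\<Sum>j | j dvd N. moebius_mu j / of_nat N ^ s) = 0"
      using sum_moebius_mu_divisors[of N] by (simp flip: sum_divide_distrib)
  qed (auto simp: moebius_mu_def)
  finally show ?thesis using has_sum_finite[of "{1::nat}" "\<lambda>_. 1 :: complex"] has_sum_unique by fastforce
qed

lemma inverse_zeta_eq_dirichlet_series:
  "1 / zeta (of_nat n + 2) = (\<Sum>j. moebius_mu j / of_nat j ^ 2 / of_nat j ^ n)"
proof -
  let ?s = "n + 2"
  have "summable (\<lambda>j. norm (1 / of_nat j ^ s :: complex))" if "s \<ge> 2" for s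
    using inverse_power_summable[OF that, where ?'a = real] by (simp add: norm_divide norm_power inverse_eq_divide)
  from this[of ?s] have Zs: "summable (\<lambda>j. norm (1 / of_nat j ^ ?s :: complex))" by simp
  have Ws: "summable (\<lambda>j. norm (moebius_mu j / of_nat j ^ ?s))"
    by (rule summable_comparison_test'[OF Zs, of 0]) 
       (auto simp: norm_divide norm_power intro!: divide_right_mono norm_moebius_mu_le_1)
  have "((\<lambda>j. 1 / of_nat j ^ ?s :: complex) has_sum (\<Sum>j. 1 / of_nat j ^ ?s)) UNIV"
    by (rule norm_summable_imp_has_sum[OF Zs summable_sums[OF summable_norm_cancel[OF Zs]]])
  also have "?this \<longleftrightarrow> ((\<lambda>j. 1 / of_nat j ^ ?s :: complex) has_sum (\<Sum>j. 1 / of_nat j ^ ?s)) {1..}"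
    by (rule has_sum_cong_neutral) (auto simp: not_less_eq_eq)
  finally have Z: "((\<lambda>j. 1 / of_nat j ^ ?s :: complex) has_sum (\<Sum>j. 1 / of_nat j ^ ?s)) {1..}" .
  have "((\<lambda>j. moebius_mu j / of_nat j ^ ?s) has_sum (\<Sum>j. moebius_mu j / of_nat j ^ ?s)) UNIV"
    by (rule norm_summable_imp_has_sum[OF Ws summable_sums[OF summable_norm_cancel[OF Ws]]])
  also have "?this \<longleftrightarrow> ((\<lambda>j. moebius_mu j / of_nat j ^ ?s) has_sum (\<Sum>j. moebius_mu j / of_nat j ^ ?s)) {1..}"
    by (rule has_sum_cong_neutral) (auto simp: not_less_eq_eq)
  finally have W: "((\<lambda>j. moebius_mu j / of_nat j ^ ?s) has_sum (\<Sum>j. moebius_mu j / of_nat j ^ ?s)) {1..}" .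
  have "(\<Sum>j. moebius_mu j / of_nat j ^ ?s) * (\<Sum>j. 1 / of_nat j ^ ?s) = 1"
    by (rule moebius_mu_dirichlet_inverse[OF Z W])
       (use norm_summable_imp_summable_on[of "\<lambda>j. norm (1 / of_nat j ^ ?s :: complex)"] Zs
            norm_summable_imp_summable_on[of "\<lambda>j. norm (moebius_mu j / of_nat j ^ ?s)"] Ws
        in \<open>auto intro: summable_on_subset_banach\<close>)
  moreover have "(\<Sum>j. 1 / of_nat j ^ ?s) = zeta (of_nat n + 2)"
  proof -
    have "(\<Sum>j. 1 / of_nat j ^ ?s) = (\<Sum>j. 1 / of_nat (Suc j) ^ ?s) + (1 / of_nat 0 ^ ?s :: complex)"
      using suminf_split_head[OF summable_norm_cancel[OF Zs]] by simp
    moreover have "of_nat (Suc j) powr (of_nat n + 2) = (of_nat (Suc j) ^ ?s :: complex)" for j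
    proof -
      have "of_nat n + 2 = (of_nat ?s :: complex)" by simp
      then show ?thesis by (simp only:) (rule powr_nat', simp)
    qed
    ultimately show ?thesis by (simp add: zeta_def del: of_nat_Suc)
  qed
  ultimately have "1 / zeta (of_nat n + 2) = (\<Sum>j. moebius_mu j / of_nat j ^ ?s)"
    by (metis mult_eq_0_iff nonzero_eq_divide_eq zero_neq_one)
  then show ?thesis by (simp add: power_add power2_eq_square mult_ac)
qed

text \<open>
  The Moebius function is nonzero at all primes.
\<close>

lemma not_holonomic_inverse_zeta: "\<not> holonomic_from m (\<lambda>n. 1 / zeta (of_nat n + 2))"
  unfolding inverse_zeta_eq_dirichlet_series
proof (rule not_holonomic_dirichlet_series)
  have "summable (\<lambda>j. 1 / real j ^ 2)"
    using inverse_power_summable[of 2, where ?'a = real] by (simp add: inverse_eq_divide)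
  then show "summable (\<lambda>j. norm (moebius_mu j / of_nat j ^ 2))"
    by (rule summable_comparison_test'[of _ 0])
       (auto simp: norm_divide norm_power intro!: divide_right_mono norm_moebius_mu_le_1)
  have "{p::nat. prime p} \<subseteq> {j. moebius_mu j / of_nat j ^ 2 \<noteq> 0}"
    by (auto simp: moebius_mu_def squarefree_prime dest: prime_gt_0_nat)
  then show "infinite {j. moebius_mu j / of_nat j ^ 2 \<noteq> 0}"
    using primes_infinite finite_subset by blast
qed simp

section \<open>Sequences whose quotients behave like powers\<close>

text \<open>
  The logarithms of the integers approximate every large real number, since consecutive ones
  become arbitrarily close.
\<close>

lemma log_nat_floor_exp_tendsto: "((\<lambda>y. ln (real (nat \<lfloor>exp y\<rfloor>)) - y) \<longlongrightarrow> 0) at_top"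
proof (rule real_tendsto_sandwich)
  show "\<forall>\<^sub>F y::real in at_top. ln (exp y - 1) - y \<le> ln (real (nat \<lfloor>exp y\<rfloor>)) - y"
    using eventually_gt_at_top[of 0]
  proof eventually_elim
    case (elim y)
    have "exp y > 1" using elim by simp
    then have "exp y - 1 > 0" "exp y - 1 \<le> real (nat \<lfloor>exp y\<rfloor>)" by linarith+
    then show ?case by simp
  qed
  show "\<forall>\<^sub>F y::real in at_top. ln (real (nat \<lfloor>exp y\<rfloor>)) - y \<le> 0"
    using eventually_gt_at_top[of 0]
  proof eventually_elim
    case (elim y)
    have "exp y > 1" using elim by simp
    then have "real (nat \<lfloor>exp y\<rfloor>) > 0" "real (nat \<lfloor>exp y\<rfloor>) \<le> exp y" by linarith+
    then have "ln (real (nat \<lfloor>exp y\<rfloor>)) \<le> ln (exp y)" by (subst ln_le_cancel_iff) auto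
    then show ?case by simp
  qed
  show "((\<lambda>y::real. ln (exp y - 1) - y) \<longlongrightarrow> 0) at_top" by real_asymp
qed simp

text \<open>
  The points \<open>cis (\<beta> ln n)\<close> accumulate at every point of the unit circle, so \<open>P\<close> vanishes on the circle.
\<close>

lemma poly_cis_log_tendsto_0_imp_zero:
  fixes P :: "complex poly" and \<beta> :: real
  assumes \<beta>: "\<beta> \<noteq> 0" and lim: "(\<lambda>n. poly P (cis (\<beta> * ln (real n)))) \<longlonglongrightarrow> 0"
  shows "P = 0"
proof (rule ccontr)
  assume "P \<noteq> 0"
  have root: "poly P (cis \<phi>) = 0" for \<phi>
  proof -
    \<comment> \<open>The angle \<open>\<beta> * y j\<close> equals \<open>\<phi>\<close> up to multiples of \<open>2 * pi\<close>, and \<open>y j\<close> tends to infinity for either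
      sign of \<open>\<beta>\<close>. So \<open>N j\<close>, the integer nearest below \<open>exp (y j)\<close>, has almost the angle \<open>\<phi>\<close>.\<close>
    define y where "y = (\<lambda>j::nat. \<phi> / \<beta> + 2 * pi / \<bar>\<beta>\<bar> * real j)"
    define N where "N = (\<lambda>j. nat \<lfloor>exp (y j)\<rfloor>)"
    have "2 * pi / \<bar>\<beta>\<bar> > 0" using \<beta> by simp
    then have y: "filterlim y at_top sequentially"
      unfolding y_def
      by (intro filterlim_tendsto_add_at_top[OF tendsto_const] filterlim_tendsto_pos_mult_at_top[OF tendsto_const] filterlim_real_sequentially)
    have N: "filterlim N at_top sequentially"
    proof -
      have "filterlim (\<lambda>y::real. nat \<lfloor>exp y\<rfloor>) at_top at_top" by real_asymp
      from filterlim_compose[OF this y] show ?thesis by (simp add: N_def)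
    qed
    have "cis (\<beta> * ln (real (N j))) = cis (\<beta> * (ln (real (N j)) - y j)) * cis \<phi>" for j
    proof -
      have "\<beta> * y j = sgn \<beta> * (2 * pi * real j) + \<phi>"
        using \<beta> by (cases "\<beta> > 0") (auto simp: y_def sgn_real_def field_simps)
      then have "cis (\<beta> * y j) = cis (sgn \<beta> * (2 * pi * real j)) * cis \<phi>"
        by (simp add: cis_mult)
      also have "cis (sgn \<beta> * (2 * pi * real j)) = 1"
        using cis_multiple_2pi[of "sgn \<beta> * real j"] by (simp add: sgn_real_def mult.left_commute split: if_splits)
      finally have "cis (\<beta> * y j) = cis \<phi>" by simp
      moreover have "cis (\<beta> * ln (real (N j))) = cis (\<beta> * (ln (real (N j)) - y j)) * cis (\<beta> * y j)"
        by (simp add: cis_mult algebra_simps)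
      ultimately show ?thesis by simp
    qed
    moreover have "(\<lambda>j. cis (\<beta> * (ln (real (N j)) - y j)) * cis \<phi>) \<longlonglongrightarrow> cis (\<beta> * 0) * cis \<phi>"
      using filterlim_compose[OF log_nat_floor_exp_tendsto y] unfolding N_def
      by (intro tendsto_intros)
    ultimately have "(\<lambda>j. cis (\<beta> * ln (real (N j)))) \<longlonglongrightarrow> cis \<phi>" by simp
    then have "(\<lambda>j. poly P (cis (\<beta> * ln (real (N j))))) \<longlonglongrightarrow> poly P (cis \<phi>)"
      by (rule tendsto_poly)
    moreover have "(\<lambda>j. poly P (cis (\<beta> * ln (real (N j))))) \<longlonglongrightarrow> 0"
      by (rule filterlim_compose[OF lim N])
    ultimately show ?thesis by (rule LIMSEQ_unique)
  qed
  have "inj_on cis {0..pi}"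
    by (rule inj_onI) (metis atLeastAtMost_iff cis.sel(1) cos_inj_pi)
  moreover have "finite (cis ` {0..pi})"
    by (rule finite_subset[OF _ poly_roots_finite[OF \<open>P \<noteq> 0\<close>]]) (use root in auto)
  ultimately have "finite {0..pi}" by (rule finite_imageD[rotated])
  then show False using infinite_Icc[of 0 pi] by simp
qed

text \<open>
  After division by \<open>f n\<close>, the term with index \<open>k\<close> of a recurrence has absolute value of order \<open>n\<close> to the
  power \<open>e k = degree (p k) - k Re \<alpha>\<close>. Let \<open>S\<close> be the set of the indices of maximal order \<open>M\<close>. After
  division by \<open>n\<close> to the power \<open>M\<close> the whole sum is, up to a null sequence, the value at
  \<open>cis (- Im \<alpha> ln n)\<close> of a nonzero polynomial \<open>P\<close> whose exponents are the elements of \<open>S\<close>. So this value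
  tends to zero. If \<open>Im \<alpha> \<noteq> 0\<close>, this forces \<open>P = 0\<close>. If \<open>\<alpha>\<close> is real,
  it is irrational, so the exponents \<open>e k\<close> are distinct, and \<open>P\<close> is a nonzero monomial,
  evaluated at the point \<open>1\<close>.
\<close>

lemma not_holonomic_power_ratio:
  fixes f :: "nat \<Rightarrow> complex" and \<alpha> :: complex
  assumes nz: "\<forall>\<^sub>F n in sequentially. f n \<noteq> 0"
    and ratio: "\<And>k. (\<lambda>n. f (n - k) / f n * of_nat n powr (of_nat k * \<alpha>)) \<longlonglongrightarrow> C k"
    and C: "\<And>k. C k \<noteq> 0" and \<alpha>: "\<alpha> \<notin> \<rat>"
  shows "\<not> holonomic_from m f"
proof (rule not_holonomic_fromI, rule ccontr)
  fix d :: nat and p :: "nat \<Rightarrow> complex poly"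
  assume rec: "\<forall>\<^sub>F n in sequentially. (\<Sum>k\<le>d. poly (p k) (of_nat n) * f (n - k)) = 0"
    and "\<not> (\<forall>k\<le>d. p k = 0)"
  define I where "I = {k\<in>{..d}. p k \<noteq> 0}"
  define e where "e = (\<lambda>k. real (degree (p k)) - real k * Re \<alpha>)"
  define M where "M = Max (e ` I)"
  define S where "S = {k\<in>I. e k = M}"
  have I: "finite I" "I \<noteq> {}" using \<open>\<not> (\<forall>k\<le>d. p k = 0)\<close> by (auto simp: I_def)
  have "M \<in> e ` I" unfolding M_def using I by (intro Max_in) auto
  then have S: "S \<noteq> {}" "finite S" "S \<subseteq> I" using I by (auto simp: S_def)
  have e_less: "e k < M" if "k \<in> I - S" for k
  proof -
    have "e k \<le> M" unfolding M_def using I that by (intro Max_ge) auto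
    then show ?thesis using that by (auto simp: S_def)
  qed
  define g where "g = (\<lambda>n::nat. cis (- Im \<alpha> * ln (real n)))"
  define T where "T = (\<lambda>k n. poly (p k) (of_nat n) / of_nat n ^ degree (p k) *
                     (f (n - k) / f n * of_nat n powr (of_nat k * \<alpha>)))"
  have T: "T k \<longlonglongrightarrow> lead_coeff (p k) * C k" for k
    unfolding T_def by (intro tendsto_mult poly_over_power_tendsto ratio) simp
  have norm_g: "norm (g n) = 1" for n by (simp add: g_def)
  have main: "\<forall>\<^sub>F n in sequentially. (\<Sum>k\<in>I. T k n * (of_real (real n powr (e k - M)) * g n ^ k)) = 0"
    using rec nz eventually_gt_at_top[of "0::nat"]
  proof eventually_elim
    case (elim n)
    have Ln_n: "Ln (of_nat n) = of_real (ln (real n))" using elim Ln_of_nat[of n] by simp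
    have "T k n * (of_real (real n powr (e k - M)) * g n ^ k) =
            poly (p k) (of_nat n) * f (n - k) * (of_real (real n powr (- M)) / f n)" for k
    proof -
      have "of_nat n powr (of_nat k * \<alpha>) * g n ^ k = of_real (real n powr (real k * Re \<alpha>))"
      proof -
        have "g n ^ k = exp (\<i> * of_real (- Im \<alpha> * ln (real n)) * of_nat k)"
          by (simp add: g_def cis_conv_exp mult.commute flip: exp_of_nat_mult)
        then have "of_nat n powr (of_nat k * \<alpha>) * g n ^ k = 
            exp (of_nat k * \<alpha> * of_real (ln (real n)) + \<i> * of_real (- Im \<alpha> * ln (real n)) * of_nat k)"
          using elim(3) unfolding powr_def Ln_n exp_add by simp
        also have "of_nat k * \<alpha> * of_real (ln (real n)) + \<i> * of_real (- Im \<alpha> * ln (real n)) * of_nat k 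
                    = of_real (real k * Re \<alpha> * ln (real n))"
          by (simp add: complex_eq_iff algebra_simps)
        finally show ?thesis using elim(3) by (simp only: exp_of_real powr_def) simp
      qed
      moreover have "real n powr (e k - M) * real n powr (real k * Re \<alpha>) = real n ^ degree (p k) * real n powr (- M)"
        using elim(3) by (simp add: e_def powr_realpow flip: powr_add powr_realpow)
      then have "complex_of_real (real n powr (e k - M)) * of_real (real n powr (real k * Re \<alpha>)) 
                  = of_nat n ^ degree (p k) * of_real (real n powr (- M))"
        by (metis of_real_mult of_real_of_nat_eq of_real_power)
      moreover have "T k n * (of_real (real n powr (e k - M)) * g n ^ k) =
         poly (p k) (of_nat n) * f (n - k) / (f n * of_nat n ^ degree (p k)) * 
           (of_real (real n powr (e k - M)) * (of_nat n powr (of_nat k * \<alpha>) * g n ^ k))"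
        by (simp add: T_def mult_ac)
      ultimately show ?thesis using elim(3) by simp
    qed
    then have "(\<Sum>k\<in>I. T k n * (of_real (real n powr (e k - M)) * g n ^ k)) =
       (\<Sum>k\<in>I. poly (p k) (of_nat n) * f (n - k)) * (of_real (real n powr (- M)) / f n)"
      by (simp add: sum_distrib_right sum_divide_distrib)
    also have "(\<Sum>k\<in>I. poly (p k) (of_nat n) * f (n - k)) = (\<Sum>k\<le>d. poly (p k) (of_nat n) * f (n - k))"
      by (rule sum.mono_neutral_left) (auto simp: I_def)
    finally show ?case using elim(1) by simp
  qed
  define P where "P = (\<Sum>k\<in>S. monom (lead_coeff (p k) * C k) k)"
  have "(\<lambda>n. (\<Sum>k\<in>I. T k n * (of_real (real n powr (e k - M)) * g n ^ k)) - poly P (g n)) \<longlonglongrightarrow> 0"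
  proof -
    have "(\<lambda>n. (T k n * (of_real (real n powr (e k - M))) - (if k \<in> S then lead_coeff (p k) * C k else 0)) * g n ^ k) \<longlonglongrightarrow> 0"
      if k: "k \<in> I" for k
    proof (rule Lim_null_comparison)
      show "\<forall>\<^sub>F n in sequentially. norm ((T k n * (of_real (real n powr (e k - M))) - (if k \<in> S then lead_coeff (p k) * C k else 0)) * g n ^ k)
         \<le> norm (T k n * (of_real (real n powr (e k - M))) - (if k \<in> S then lead_coeff (p k) * C k else 0))"
        by (simp add: norm_mult norm_power norm_g)
      have "(\<lambda>n. T k n * of_real (real n powr (e k - M))) \<longlonglongrightarrow> (if k \<in> S then lead_coeff (p k) * C k else 0)"
      proof (cases "k \<in> S")
        case True
        have "\<forall>\<^sub>F n in sequentially. T k n = T k n * of_real (real n powr (e k - M))"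
          using eventually_gt_at_top[of "0::nat"] by eventually_elim (use True in \<open>simp add: S_def\<close>)
        from Lim_transform_eventually[OF T this] show ?thesis using True by simp
      next
        case False
        have "(\<lambda>n. real n powr (e k - M)) \<longlonglongrightarrow> 0"
          using e_less[of k] False k by (intro tendsto_neg_powr filterlim_real_sequentially) auto
        then have "(\<lambda>n. T k n * of_real (real n powr (e k - M))) \<longlonglongrightarrow> lead_coeff (p k) * C k * of_real 0"
          by (intro tendsto_mult T tendsto_of_real)
        then show ?thesis using False by simp
      qed
      then have "(\<lambda>n. T k n * of_real (real n powr (e k - M)) - (if k \<in> S then lead_coeff (p k) * C k else 0)) \<longlonglongrightarrow> 0"
        by (simp add: LIM_zero)
      then show "(\<lambda>n. norm (T k n * of_real (real n powr (e k - M)) - (if k \<in> S then lead_coeff (p k) * C k else 0))) \<longlonglongrightarrow> 0"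
        by (rule tendsto_norm_zero)
    qed
    then have "(\<lambda>n. \<Sum>k\<in>I. (T k n * (of_real (real n powr (e k - M))) - (if k \<in> S then lead_coeff (p k) * C k else 0)) * g n ^ k) \<longlonglongrightarrow> (\<Sum>k\<in>I. 0)"
      by (rule tendsto_sum)
    moreover have "poly P (g n) = (\<Sum>k\<in>I. (if k \<in> S then lead_coeff (p k) * C k else 0) * g n ^ k)" for n
      unfolding P_def poly_sum poly_monom
      by (rule sum.mono_neutral_cong_left) (use S I in auto)
    ultimately show ?thesis
      by (simp add: left_diff_distrib sum_subtractf mult.assoc)
  qed
  then have "(\<lambda>n. 0 - poly P (g n)) \<longlonglongrightarrow> 0"
    by (rule Lim_transform_eventually) (use main in \<open>auto elim: eventually_mono\<close>)
  from tendsto_minus[OF this] have lim: "(\<lambda>n. poly P (g n)) \<longlonglongrightarrow> 0" by simp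
  obtain k where k: "k \<in> S" using S by blast
  have coeff_k: "coeff P k = lead_coeff (p k) * C k" if "k \<in> S" for k
    using S(2) that by (simp add: P_def coeff_sum)
  have "coeff P k \<noteq> 0" using coeff_k[OF k] k S(3) C by (auto simp: I_def)
  show False
  proof (cases "Im \<alpha> = 0")
    case False
    then show False using poly_cis_log_tendsto_0_imp_zero[of "- Im \<alpha>" P] lim \<open>coeff P k \<noteq> 0\<close>
      by (simp add: g_def)
  next
    case True
    have "l = k" if l: "l \<in> S" for l
    proof (rule ccontr)
      assume "l \<noteq> k"
      have "real (degree (p l)) - real l * Re \<alpha> = real (degree (p k)) - real k * Re \<alpha>"
        using l k by (simp add: S_def e_def)
      then have "Re \<alpha> = (real (degree (p l)) - real (degree (p k))) / (real l - real k)"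
        using \<open>l \<noteq> k\<close> by (simp add: field_simps)
      then have "of_real (Re \<alpha>) = ((of_nat (degree (p l)) - of_nat (degree (p k))) / (of_nat l - of_nat k) :: complex)"
        by (metis of_real_diff of_real_divide of_real_of_nat_eq)
      also have "\<dots> \<in> \<rat>" by (intro Rats_divide Rats_diff Rats_of_nat)
      finally show False using \<alpha> True by (metis complex_is_Real_iff of_real_Re)
    qed
    then have "S = {k}" using k by blast
    then have "poly P (g n) = coeff P k" for n
      using True coeff_k[OF k] by (simp add: P_def g_def poly_monom)
    then show False using lim \<open>coeff P k \<noteq> 0\<close> by (simp add: LIMSEQ_const_iff)
  qed
qed

section \<open>Quotients of Gamma values\<close>

lemma Ln_one_plus_reciprocal:
  assumes w: "Re w \<ge> 0" "w \<noteq> 0"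
  shows "Ln (1 + 1 / w) = Ln (w + 1) - Ln w"
proof (rule Ln_unique)
  have w1: "w + 1 \<noteq> 0" "Re (w + 1) > 0" using w(1) by (auto simp: complex_eq_iff)
  show "exp (Ln (w + 1) - Ln w) = 1 + 1 / w"
    using w w1 by (simp add: exp_diff add_divide_distrib)
  have "\<bar>Im (Ln (w + 1))\<bar> < pi / 2" "\<bar>Im (Ln w)\<bar> \<le> pi / 2"
    using w w1 Re_Ln_pos_lt_imp Re_Ln_pos_le by blast+
  then show "- pi < Im (Ln (w + 1) - Ln w)" "Im (Ln (w + 1) - Ln w) \<le> pi" by auto
qed

lemma sum_reciprocal_squares_le:
  fixes R :: real
  assumes "R > 1"
  shows "(\<Sum>j\<le>n. 1 / (R + real j)\<^sup>2) \<le> 1 / (R - 1)"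
proof -
  have "(\<Sum>j\<le>n. 1 / (R + real j)\<^sup>2) \<le> (\<Sum>j\<le>n. 1 / (R + real j - 1) - 1 / (R + real (Suc j) - 1))"
  proof (rule sum_mono)
    fix j
    have pos: "R + real j - 1 > 0" using assms by simp
    have "1 / (R + real j - 1) - 1 / (R + real (Suc j) - 1) = 1 / ((R + real j - 1) * (R + real j))"
      using pos by (simp add: field_simps)
    moreover have "(R + real j - 1) * (R + real j) \<le> (R + real j)\<^sup>2"
      using pos by (simp add: power2_eq_square)
    ultimately show "1 / (R + real j)\<^sup>2 \<le> 1 / (R + real j - 1) - 1 / (R + real (Suc j) - 1)"
      using pos by (simp add: divide_left_mono)
  qed
  also have "\<dots> = 1 / (R + real 0 - 1) - 1 / (R + real (Suc n) - 1)"
    by (rule sum_telescope)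
  also have "\<dots> \<le> 1 / (R - 1)" using assms by simp
  finally show ?thesis .
qed

text \<open>
  In the limit formula \<open>\<Gamma> z = lim n! n\<^sup>z / (z (z + 1) \<dots> (z + n))\<close> the quotient for \<open>z + a\<close> and \<open>z\<close> is, up to
  a factor that tends to \<open>z\<^sup>a\<close>, the product of the numbers
  \<open>(1 + 1 / w\<^sub>j)\<^sup>a / (1 + a / w\<^sub>j) = exp (t j)\<close> with \<open>w\<^sub>j = z + j\<close>, because the first factors telescope.
  Each \<open>t j\<close> is of order \<open>1 / \<bar>w\<^sub>j\<bar>\<^sup>2\<close>, since its linear terms cancel. For \<open>Re z \<ge> 0\<close> the sum of these bounds
  is of order \<open>1 / \<bar>z\<bar>\<close>, uniformly in the number of factors.
\<close>

lemma Gamma_shift_ratio_bound: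
  fixes z a :: complex
  assumes Re: "Re z \<ge> 0" and z: "norm z \<ge> 2" "norm z \<ge> 2 * norm a"
    and small: "4 * (norm a + (norm a)\<^sup>2) / (norm z - 1) \<le> 1 / 2"
  shows "norm (Gamma (z + a) / Gamma z * z powr (- a) - 1) \<le> 6 * (norm a + (norm a)\<^sup>2) / (norm z - 1)"
proof -
  define C where "C = 2 * (norm a + (norm a)\<^sup>2)"
  define w where "w = (\<lambda>j::nat. z + of_nat j)"
  define t where "t = (\<lambda>j. a * Ln (1 + 1 / w j) - Ln (1 + a / w j))"
  define L where "L = Gamma (z + a) / Gamma z * z powr (- a)"
  have w_sq: "(norm z)\<^sup>2 + (real j)\<^sup>2 \<le> (norm (w j))\<^sup>2" for j
  proof -
    have "(norm (w j))\<^sup>2 = (norm z)\<^sup>2 + (real j)\<^sup>2 + 2 * real j * Re z"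
      unfolding w_def cmod_power2 by (simp add: power2_eq_square algebra_simps)
    then show ?thesis using Re by simp
  qed
  have w_ge: "(norm (w j))\<^sup>2 \<ge> (norm z + real j)\<^sup>2 / 2" for j
  proof -
    have "(norm z + real j)\<^sup>2 \<le> 2 * ((norm z)\<^sup>2 + (real j)\<^sup>2)"
      using zero_le_power2[of "norm z - real j"] by (simp add: power2_eq_square algebra_simps)
    then show ?thesis using w_sq[of j] by simp
  qed
  have w_ge_z: "norm (w j) \<ge> norm z" for j
    by (rule power2_le_imp_le[OF order_trans[OF _ w_sq]]) auto
  have w0: "w j \<noteq> 0" "Re (w j) \<ge> 0" for j using w_ge_z[of j] z(1) Re by (auto simp: w_def)
  have wa: "norm (a / w j) \<le> 1 / 2" "norm (1 / w j) \<le> 1 / 2" for j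
  proof -
    have "norm a \<le> 1 / 2 * norm (w j)" "1 \<le> 1 / 2 * norm (w j)" using w_ge_z[of j] z by linarith+
    then show "norm (a / w j) \<le> 1 / 2" "norm (1 / w j) \<le> 1 / 2"
      using w0(1)[of j] by (simp_all add: norm_divide pos_divide_le_eq)
  qed
  have wa0: "w j + a \<noteq> 0" for j
  proof
    assume "w j + a = 0"
    then have "a = - w j" by (simp add: eq_neg_iff_add_eq_0 add.commute)
    then show False using w_ge_z[of j] z w0[of j] by simp
  qed
  have log_bound: "norm (Ln (1 + x) - x) \<le> 2 * (norm x)\<^sup>2" if x: "norm x \<le> 1 / 2" for x :: complex
  proof -
    have "norm (Ln (1 + x) - x) \<le> (norm x)\<^sup>2 / (1 - norm x)"
      by (rule Ln_approx_linear) (use x in simp)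
    also have "\<dots> \<le> (norm x)\<^sup>2 / (1 / 2)" by (rule divide_left_mono) (use x in auto)
    finally show ?thesis by simp
  qed
  have t_bound: "norm (t j) \<le> C * (2 / (norm z + real j)\<^sup>2)" for j
  proof -
    have "t j = a * (Ln (1 + 1 / w j) - 1 / w j) - (Ln (1 + a / w j) - a / w j)"
      by (simp add: t_def algebra_simps)
    also have "norm \<dots> \<le> norm a * norm (Ln (1 + 1 / w j) - 1 / w j) + norm (Ln (1 + a / w j) - a / w j)"
      by (rule order_trans[OF norm_triangle_ineq4]) (simp add: norm_mult)
    also have "\<dots> \<le> norm a * (2 * (norm (1 / w j))\<^sup>2) + 2 * (norm (a / w j))\<^sup>2"
      by (intro add_mono mult_left_mono log_bound wa) simp
    also have "\<dots> = C * (1 / (norm (w j))\<^sup>2)"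
      by (simp add: C_def norm_divide power_divide add_divide_distrib ring_distribs)
    also have "\<dots> \<le> C * (1 / ((norm z + real j)\<^sup>2 / 2))"
      using z(1) w_ge[of j] by (intro mult_left_mono divide_left_mono mult_pos_pos) (auto simp: C_def w0)
    finally show ?thesis by simp
  qed
  have S_bound: "norm (\<Sum>j\<le>n. t j) \<le> 2 * C / (norm z - 1)" for n
  proof -
    have "norm (\<Sum>j\<le>n. t j) \<le> (\<Sum>j\<le>n. C * (2 / (norm z + real j)\<^sup>2))"
      by (rule sum_norm_le) (rule t_bound)
    also have "\<dots> = 2 * C * (\<Sum>j\<le>n. 1 / (norm z + real j)\<^sup>2)"
      by (simp add: sum_distrib_left mult_ac)
    also have "\<dots> \<le> 2 * C * (1 / (norm z - 1))"
      using z(1) by (intro mult_left_mono sum_reciprocal_squares_le) (auto simp: C_def)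
    finally show ?thesis by simp
  qed
  have exp_S: "exp (\<Sum>j\<le>n. t j) = exp (a * (Ln (w (Suc n)) - Ln z)) * (pochhammer z (Suc n) / pochhammer (z + a) (Suc n))" for n
  proof -
    have "exp (t j) = exp (a * (Ln (w (Suc j)) - Ln (w j))) * (w j / (w j + a))" for j
    proof -
      have "Ln (1 + 1 / w j) = Ln (w (Suc j)) - Ln (w j)"
        using Ln_one_plus_reciprocal[OF w0(2,1), of j] by (simp add: w_def add_ac)
      moreover have "1 + a / w j = (w j + a) / w j" using w0 by (simp add: add_divide_distrib)
      moreover have "(w j + a) / w j \<noteq> 0" using w0 wa0 by simp
      ultimately show ?thesis by (simp add: t_def exp_diff)
    qed
    then have "exp (\<Sum>j\<le>n. t j) = (\<Prod>j\<le>n. exp (a * (Ln (w (Suc j)) - Ln (w j)))) * (\<Prod>j\<le>n. w j / (w j + a))"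
      by (simp only: exp_sum[OF finite_atMost] prod.distrib)
    also have "(\<Prod>j\<le>n. exp (a * (Ln (w (Suc j)) - Ln (w j)))) = exp (a * (\<Sum>j\<le>n. Ln (w (Suc j)) - Ln (w j)))"
      by (simp add: exp_sum sum_distrib_left)
    also have "(\<Sum>j\<le>n. Ln (w (Suc j)) - Ln (w j)) = Ln (w (Suc n)) - Ln z"
      using sum_telescope[of "\<lambda>j. - Ln (w j)" n] by (simp add: w_def)
    also have "(\<Prod>j\<le>n. w j / (w j + a)) = pochhammer z (Suc n) / pochhammer (z + a) (Suc n)"
      by (simp add: pochhammer_prod prod_dividef w_def atLeast0LessThan lessThan_Suc_atMost add_ac
               del: prod.lessThan_Suc prod.atMost_Suc)
    finally show ?thesis .
  qed
  have poch: "pochhammer z (Suc n) \<noteq> 0" "pochhammer (z + a) (Suc n) \<noteq> 0" for n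
    using w0(1) wa0 by (auto simp: pochhammer_eq_0_iff w_def add_ac eq_neg_iff_add_eq_0)
  have "z \<notin> \<int>\<^sub>\<le>\<^sub>0"
  proof
    assume "z \<in> \<int>\<^sub>\<le>\<^sub>0"
    then obtain j where "z = - of_nat j" by (elim nonpos_Ints_cases')
    then show False using w0(1)[of j] by (simp add: w_def)
  qed
  then have Gz: "Gamma z \<noteq> 0" by (rule Gamma_nonzero)
  \<comment> \<open>The telescoping product ends with \<open>(z + n + 1)\<^sup>a\<close> instead of \<open>n\<^sup>a\<close>; the quotient of these two is \<open>Y n\<close>.\<close>
  define Y where "Y = (\<lambda>n. exp (a * (Ln (w (Suc n)) - of_real (ln (real n)))))"
  have lim: "(\<lambda>n. Gamma_series (z + a) n / Gamma_series z n * z powr (- a) * Y n) \<longlonglongrightarrow> L * 1"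
    unfolding L_def
  proof (intro tendsto_mult tendsto_divide Gamma_series_LIMSEQ tendsto_const Gz)
    have "(\<lambda>n. (z + 1) * inverse (of_nat n) + 1) \<longlonglongrightarrow> (z + 1) * 0 + 1"
      by (intro tendsto_intros lim_inverse_n)
    then have "(\<lambda>n. Ln ((z + 1) * inverse (of_nat n) + 1)) \<longlonglongrightarrow> Ln 1"
      by (intro tendsto_Ln) auto
    moreover have "\<forall>\<^sub>F n in sequentially. Ln ((z + 1) * inverse (of_nat n) + 1) = Ln (w (Suc n)) - of_real (ln (real n))"
      using eventually_gt_at_top[of "0::nat"]
    proof eventually_elim
      case (elim n)
      define v where "v = (z + 1) * inverse (of_nat n) + 1"
      have w_v: "w (Suc n) = of_real (real n) * v"
        using elim by (simp add: w_def v_def field_simps)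
      then have "v \<noteq> 0" using w0(1)[of "Suc n"] by auto
      then have "Ln (of_real (real n) * v) = of_real (ln (real n)) + Ln v"
        by (subst Ln_times_of_real) (use elim in auto)
      then show ?case unfolding w_v v_def[symmetric] by simp
    qed
    ultimately have "(\<lambda>n. Ln (w (Suc n)) - of_real (ln (real n))) \<longlonglongrightarrow> 0"
      using Lim_transform_eventually by fastforce
    then have "Y \<longlonglongrightarrow> exp (a * 0)" unfolding Y_def by (intro tendsto_intros)
    then show "Y \<longlonglongrightarrow> 1" by simp
  qed
  have "Gamma_series (z + a) n / Gamma_series z n * z powr (- a) * Y n = exp (\<Sum>j\<le>n. t j)" for n
  proof -
    have "z \<noteq> 0" using w0(1)[of 0] by (simp add: w_def)
    have "Gamma_series (z + a) n / Gamma_series z n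
        = exp (a * of_real (ln (real n))) * (pochhammer z (Suc n) / pochhammer (z + a) (Suc n))"
      using poch[of n] by (simp add: Gamma_series_def ring_distribs exp_add)
    then have "Gamma_series (z + a) n / Gamma_series z n * z powr (- a) * Y n =
         (exp (a * of_real (ln (real n))) * exp (- a * Ln z) * Y n) * (pochhammer z (Suc n) / pochhammer (z + a) (Suc n))"
      using \<open>z \<noteq> 0\<close> by (simp only: powr_def if_False) simp
    also have "exp (a * of_real (ln (real n))) * exp (- a * Ln z) * Y n = exp (a * (Ln (w (Suc n)) - Ln z))"
      unfolding Y_def exp_add[symmetric] by (simp add: algebra_simps)
    finally show ?thesis unfolding exp_S .
  qed
  with lim have lim: "(\<lambda>n. exp (\<Sum>j\<le>n. t j)) \<longlonglongrightarrow> L" by simp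
  have "norm (exp (\<Sum>j\<le>n. t j) - 1) \<le> 6 * (norm a + (norm a)\<^sup>2) / (norm z - 1)" for n
  proof -
    have "norm (\<Sum>j\<le>n. t j) \<le> 1 / 2"
      by (rule order_trans[OF S_bound]) (use small in \<open>simp add: C_def\<close>)
    then have "norm (exp (\<Sum>j\<le>n. t j) - 1) \<le> 3 / 2 * norm (\<Sum>j\<le>n. t j)"
      by (rule norm_exp_bounds)
    also have "\<dots> \<le> 3 / 2 * (2 * C / (norm z - 1))" by (intro mult_left_mono S_bound) simp
    also have "\<dots> = 6 * (norm a + (norm a)\<^sup>2) / (norm z - 1)"
    proof -
      have "3 / 2 * (2 * c / D) = 3 * c / D" for c D :: real by (cases "D = 0") auto
      moreover have "3 * C = 6 * (norm a + (norm a)\<^sup>2)" by (simp add: C_def)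
      ultimately show ?thesis by (simp only:)
    qed
    finally show ?thesis .
  qed
  then have "norm (L - 1) \<le> 6 * (norm a + (norm a)\<^sup>2) / (norm z - 1)"
    by (intro LIMSEQ_le_const2[OF tendsto_norm[OF tendsto_diff[OF lim tendsto_const]]]) blast
  then show ?thesis by (simp add: L_def)
qed

lemma Gamma_shift_ratio_tendsto:
  fixes z :: "nat \<Rightarrow> complex" and a :: complex
  assumes Re: "\<And>n. Re (z n) \<ge> 0" and z: "filterlim (\<lambda>n. norm (z n)) at_top sequentially"
  shows "(\<lambda>n. Gamma (z n + a) / Gamma (z n) * z n powr (- a)) \<longlonglongrightarrow> 1"
proof -
  have top: "filterlim (\<lambda>n. norm (z n) - 1) at_top sequentially"
    using filterlim_tendsto_add_at_top[OF tendsto_const[of "- 1"] z] by simp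
  have lim: "(\<lambda>n. c / (norm (z n) - 1)) \<longlonglongrightarrow> 0" for c :: real
    by (rule tendsto_divide_0[OF tendsto_const filterlim_at_top_imp_at_infinity[OF top]])
  have "\<forall>\<^sub>F n in sequentially. 4 * (norm a + (norm a)\<^sup>2) / (norm (z n) - 1) < 1 / 2"
    by (rule order_tendstoD(2)[OF lim]) simp
  moreover have "\<forall>\<^sub>F n in sequentially. norm (z n) \<ge> max 2 (2 * norm a)"
    using z unfolding filterlim_at_top by blast
  ultimately have "\<forall>\<^sub>F n in sequentially. norm (Gamma (z n + a) / Gamma (z n) * z n powr (- a) - 1)
                     \<le> 6 * (norm a + (norm a)\<^sup>2) / (norm (z n) - 1)"
    by eventually_elim (intro Gamma_shift_ratio_bound Re, auto)
  then have "(\<lambda>n. Gamma (z n + a) / Gamma (z n) * z n powr (- a) - 1) \<longlonglongrightarrow> 0"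
    by (rule Lim_null_comparison[OF _ lim])
  then show ?thesis by (simp add: LIM_zero_iff)
qed

text \<open>
  Apply the asymptotics at \<open>z = n \<omega>\<close> with shift \<open>a = - k \<omega>\<close>, and split \<open>(n \<omega>)\<^sup>k\<^sup>\<omega>\<close> into
  \<open>n\<^sup>k\<^sup>\<omega>\<close> and \<open>\<omega>\<^sup>k\<^sup>\<omega>\<close>.
\<close>

lemma Gamma_multiples_ratio_tendsto:
  fixes \<omega> :: complex
  assumes \<omega>: "Re \<omega> \<ge> 0" "\<omega> \<noteq> 0"
  shows "(\<lambda>n. Gamma (of_nat (n - k) * \<omega>) / Gamma (of_nat n * \<omega>) * of_nat n powr (of_nat k * \<omega>))
           \<longlonglongrightarrow> \<omega> powr (- (of_nat k * \<omega>))"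
proof -
  let ?a = "- (of_nat k * \<omega>)"
  have "filterlim (\<lambda>n. norm \<omega> * real n) at_top sequentially"
    by (rule filterlim_tendsto_pos_mult_at_top[OF tendsto_const _ filterlim_real_sequentially]) (use \<omega> in simp)
  then have "filterlim (\<lambda>n. norm (of_nat n * \<omega>)) at_top sequentially"
    by (simp add: norm_mult mult.commute)
  from Gamma_shift_ratio_tendsto[OF _ this, of ?a]
  have "(\<lambda>n. Gamma (of_nat n * \<omega> + ?a) / Gamma (of_nat n * \<omega>) * (of_nat n * \<omega>) powr (- ?a)) \<longlonglongrightarrow> 1"
    using \<omega> by simp
  from tendsto_mult_right[OF this, of "\<omega> powr ?a"]
  have "(\<lambda>n. Gamma (of_nat n * \<omega> + ?a) / Gamma (of_nat n * \<omega>) * (of_nat n * \<omega>) powr (- ?a) * \<omega> powr ?a) \<longlonglongrightarrow> \<omega> powr ?a"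
    by simp
  moreover have "\<forall>\<^sub>F n in sequentially. Gamma (of_nat n * \<omega> + ?a) / Gamma (of_nat n * \<omega>) * (of_nat n * \<omega>) powr (- ?a) * \<omega> powr ?a
      = Gamma (of_nat (n - k) * \<omega>) / Gamma (of_nat n * \<omega>) * of_nat n powr (of_nat k * \<omega>)"
    using eventually_gt_at_top[of k]
  proof eventually_elim
    case (elim n)
    have "Ln (of_real (real n) * \<omega>) = of_real (ln (real n)) + Ln \<omega>"
      by (subst Ln_times_of_real) (use elim \<omega> in auto)
    moreover have "Ln (of_nat n) = of_real (ln (real n))" using elim Ln_of_nat[of n] by simp
    ultimately have "(of_nat n * \<omega>) powr (- ?a) * \<omega> powr ?a = of_nat n powr (of_nat k * \<omega>)"
      using elim \<omega> by (simp add: powr_def ring_distribs flip: exp_add)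
    moreover have "of_nat n * \<omega> + ?a = of_nat (n - k) * \<omega>"
      using elim by (simp add: of_nat_diff ring_distribs)
    ultimately show ?case by (simp add: mult.assoc)
  qed
  ultimately show ?thesis by (rule Lim_transform_eventually)
qed

text \<open>
  In \<open>m\<^sup>2 = p n\<^sup>2\<close> the prime \<open>p\<close> has even multiplicity on the left and odd multiplicity on the right.
\<close>

lemma sqrt_prime_irrational:
  fixes p :: nat
  assumes "prime p"
  shows "sqrt p \<notin> \<rat>"
proof
  assume "sqrt p \<in> \<rat>"
  then obtain m n :: nat where n: "n \<noteq> 0" and mn: "\<bar>sqrt p\<bar> = m / n"
    by (rule Rats_abs_nat_div_natE)
  have "real m = sqrt p * n" using n mn by (simp add: field_simps)
  then have "(real m)\<^sup>2 = real p * (real n)\<^sup>2" by (simp add: power_mult_distrib)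
  then have eq: "m\<^sup>2 = p * n\<^sup>2" by (metis of_nat_eq_iff of_nat_mult of_nat_power)
  have "m \<noteq> 0" using eq n prime_gt_0_nat[OF assms] by (cases m) auto
  have "multiplicity p (m\<^sup>2) = multiplicity p (p * n\<^sup>2)" by (simp only: eq)
  then have "2 * multiplicity p m = Suc (2 * multiplicity p n)"
    using assms n \<open>m \<noteq> 0\<close> prime_gt_0_nat[OF assms]
    by (simp add: prime_elem_multiplicity_mult_distrib prime_elem_multiplicity_power_distrib)
  then show False by presburger
qed

text \<open>
  If the difference \<open>x\<close> were rational, the equation \<open>(x + sqrt 3)\<^sup>2 = 2\<close> would make \<open>sqrt 3\<close> rational.
\<close>

lemma sqrt_2_minus_sqrt_3_irrational: "sqrt 2 - sqrt 3 \<notin> \<rat>"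
proof
  define x where "x = sqrt 2 - sqrt 3"
  assume "sqrt 2 - sqrt 3 \<in> \<rat>"
  then have x: "x \<in> \<rat>" by (simp add: x_def)
  have "x \<noteq> 0" by (simp add: x_def)
  have "(x + sqrt 3)\<^sup>2 = 2" by (simp add: x_def)
  then have "sqrt 3 = (- 1 - x\<^sup>2) / (2 * x)"
    using \<open>x \<noteq> 0\<close> by (simp add: power2_sum field_simps)
  also have "\<dots> \<in> \<rat>" using x by (intro Rats_divide Rats_diff Rats_mult Rats_power) auto
  finally show False using sqrt_prime_irrational[of 3] by simp
qed

lemma imaginary_unit_irrational: "\<i> \<notin> \<rat>"
proof
  assume "\<i> \<in> \<rat>"
  then obtain q where q: "\<i> = of_rat q" by (auto elim: Rats_cases)
  also have "\<dots> = complex_of_real (of_rat q)" by (cases q) (simp add: of_rat_rat)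
  finally have "Im \<i> = Im (complex_of_real (of_rat q))" by (rule arg_cong)
  then show False by simp
qed

lemma Gamma_multiple_nonzero:
  fixes \<omega> :: complex
  assumes \<omega>: "Re \<omega> \<ge> 0" "\<omega> \<noteq> 0"
  shows "\<forall>\<^sub>F n in sequentially. Gamma (of_nat n * \<omega>) \<noteq> 0"
  using eventually_gt_at_top[of "0::nat"]
proof eventually_elim
  case (elim n)
  have "of_nat n * \<omega> \<notin> \<int>\<^sub>\<le>\<^sub>0"
  proof
    assume "of_nat n * \<omega> \<in> \<int>\<^sub>\<le>\<^sub>0"
    then obtain j where j: "of_nat n * \<omega> = - of_nat j" by (elim nonpos_Ints_cases')
    then have "real n * Re \<omega> = - real j" by (simp add: complex_eq_iff)
    moreover have "real n * Re \<omega> \<ge> 0" using \<omega> by simp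
    ultimately have "j = 0" by simp
    then show False using j elim \<omega> by simp
  qed
  then show ?case by (rule Gamma_nonzero)
qed

lemma not_holonomic_Gamma_multiples:
  fixes \<omega> :: complex
  assumes \<omega>: "Re \<omega> \<ge> 0" "\<omega> \<notin> \<rat>"
  shows "\<not> holonomic_from m (\<lambda>n. Gamma (of_nat n * \<omega>))"
proof -
  have "\<omega> \<noteq> 0" using \<omega>(2) by auto
  with \<omega> show ?thesis
    by (intro not_holonomic_power_ratio[OF Gamma_multiple_nonzero Gamma_multiples_ratio_tendsto]) auto
qed

lemma not_holonomic_Gamma_multiples_quotient:
  fixes \<omega> \<rho> :: complex
  assumes \<omega>: "Re \<omega> \<ge> 0" "\<omega> \<noteq> 0" and \<rho>: "Re \<rho> \<ge> 0" "\<rho> \<noteq> 0" and irr: "\<omega> - \<rho> \<notin> \<rat>"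
  shows "\<not> holonomic_from m (\<lambda>n. Gamma (of_nat n * \<omega>) / Gamma (of_nat n * \<rho>))"
proof (rule not_holonomic_power_ratio[where \<alpha> = "\<omega> - \<rho>" and 
      C = "\<lambda>k. \<omega> powr (- (of_nat k * \<omega>)) / \<rho> powr (- (of_nat k * \<rho>))"])
  show "\<forall>\<^sub>F n in sequentially. Gamma (of_nat n * \<omega>) / Gamma (of_nat n * \<rho>) \<noteq> 0"
    using Gamma_multiple_nonzero[OF \<omega>] Gamma_multiple_nonzero[OF \<rho>] by eventually_elim simp
  fix k
  let ?f = "\<lambda>\<omega> n. Gamma (of_nat (n - k) * \<omega>) / Gamma (of_nat n * \<omega>) * of_nat n powr (of_nat k * \<omega>) :: complex"
  have "(\<lambda>n. ?f \<omega> n / ?f \<rho> n) \<longlonglongrightarrow> \<omega> powr (- (of_nat k * \<omega>)) / \<rho> powr (- (of_nat k * \<rho>))"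
    by (intro tendsto_divide Gamma_multiples_ratio_tendsto \<omega> \<rho>) (use \<rho> in auto)
  moreover have "?f \<omega> n / ?f \<rho> n = 
      Gamma (of_nat (n - k) * \<omega>) / Gamma (of_nat (n - k) * \<rho>) /
       (Gamma (of_nat n * \<omega>) / Gamma (of_nat n * \<rho>)) * of_nat n powr (of_nat k * (\<omega> - \<rho>))" for n
    by (simp add: right_diff_distrib powr_diff mult_ac)
  ultimately show "(\<lambda>n. Gamma (of_nat (n - k) * \<omega>) / Gamma (of_nat (n - k) * \<rho>) /
       (Gamma (of_nat n * \<omega>) / Gamma (of_nat n * \<rho>)) * of_nat n powr (of_nat k * (\<omega> - \<rho>)))
      \<longlonglongrightarrow> \<omega> powr (- (of_nat k * \<omega>)) / \<rho> powr (- (of_nat k * \<rho>))" by simp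
qed (use \<omega> \<rho> irr in auto)

section \<open>Rings of germs without oscillation\<close>

text \<open>
  A differential ring of functions of a real variable, considered near infinity, none of whose elements
  has zeros at arbitrarily large arguments unless it vanishes from some point on. It is a ring
  version of a Hardy field: not having inverses in the ring avoids a convention for quotients by
  functions that vanish somewhere.
\<close>

locale hardy_ring =
  fixes R :: "(real \<Rightarrow> real) set"
  assumes const: "(\<lambda>_. c) \<in> R"
    and add: "f \<in> R \<Longrightarrow> g \<in> R \<Longrightarrow> (\<lambda>x. f x + g x) \<in> R"
    and mult: "f \<in> R \<Longrightarrow> g \<in> R \<Longrightarrow> (\<lambda>x. f x * g x) \<in> R"
    and deriv: "f \<in> R \<Longrightarrow> \<exists>g\<in>R. \<forall>\<^sub>F x in at_top. (f has_real_derivative g x) (at x)"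
    and zero_or_nonzero: "f \<in> R \<Longrightarrow> (\<forall>\<^sub>F x in at_top. f x = 0) \<or> (\<forall>\<^sub>F x in at_top. f x \<noteq> 0)"
begin

lemma sum:
  assumes "\<And>i. i \<in> I \<Longrightarrow> f i \<in> R"
  shows "(\<lambda>x. \<Sum>i\<in>I. f i x) \<in> R"
proof (cases "finite I")
  case True
  then show ?thesis using assms
    by (induction I rule: finite_induct) (auto intro: add const)
qed (simp add: const)

end

text \<open>
  All polynomials in \<open>E\<close> with coefficients from \<open>R\<close>. The coefficient sequence is zero beyond \<open>n\<close>
  so that polynomials of different degrees can be added and multiplied coefficientwise.
\<close>

definition adjoin :: "(real \<Rightarrow> real) set \<Rightarrow> (real \<Rightarrow> real) \<Rightarrow> (real \<Rightarrow> real) set" where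
  "adjoin R E = {f. \<exists>A n. (\<forall>i. A i \<in> R) \<and> (\<forall>i>n. A i = (\<lambda>_. 0)) \<and>
     f = (\<lambda>x. \<Sum>i\<le>n. A i x * E x ^ i)}"

context hardy_ring begin

lemma adjoin_superset: "R \<subseteq> adjoin R E"
proof
  fix f assume f: "f \<in> R"
  define A where "A = (\<lambda>i::nat. if i = 0 then f else (\<lambda>_. 0))"
  show "f \<in> adjoin R E" unfolding adjoin_def
    by (rule CollectI, rule exI[of _ A], rule exI[of _ 0]) (auto simp: A_def f const)
qed

lemma adjoin_generator: "E \<in> adjoin R E"
proof -
  define A where "A = (\<lambda>i::nat. if i = 1 then (\<lambda>_::real. 1::real) else (\<lambda>_. 0))"
  have "E = (\<lambda>x::real. \<Sum>i\<le>Suc 0. A i x * E x ^ i)" by (simp add: A_def)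
  moreover have "A i \<in> R" for i by (simp add: A_def const)
  ultimately show ?thesis unfolding adjoin_def
    by (intro CollectI exI[of _ A] exI[of _ "Suc 0"]) (auto simp: A_def)
qed

text \<open>
  Induction on the degree \<open>n\<close> of the polynomial \<open>S\<close> in \<open>E\<close>. If the constant coefficient vanishes, a factor \<open>E\<close> can be
  split off. Otherwise divide by the constant coefficient \<open>A 0\<close> and differentiate. As \<open>E' = g E\<close>,
  differentiation removes the constant term and keeps the powers of \<open>E\<close>, so the derivative of \<open>S / A 0\<close>
  is \<open>E / (A 0)\<^sup>2\<close> times a polynomial \<open>T\<close> of smaller degree. If \<open>T\<close> vanishes near infinity, \<open>S / A 0\<close> is
  constant there. If \<open>T\<close> has no zeros near infinity, \<open>S / A 0\<close> has at most one by Rolle's theorem.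
\<close>

lemma adjoin_zero_or_nonzero:
  assumes nz: "\<forall>\<^sub>F x in at_top. E x \<noteq> 0"
    and g: "g \<in> R" and E': "\<forall>\<^sub>F x in at_top. (E has_real_derivative g x * E x) (at x)"
    and A: "\<And>i. A i \<in> R"
  shows "(\<forall>\<^sub>F x in at_top. (\<Sum>i\<le>n. A i x * E x ^ i) = 0) \<or>
         (\<forall>\<^sub>F x in at_top. (\<Sum>i\<le>n. A i x * E x ^ i) \<noteq> 0)"
  using A
proof (induction n arbitrary: A)
  case 0
  then show ?case using zero_or_nonzero by simp
next
  case (Suc n)
  let ?S = "\<lambda>x. \<Sum>i\<le>Suc n. A i x * E x ^ i"
  have "(\<forall>\<^sub>F x in at_top. A 0 x = 0) \<or> (\<forall>\<^sub>F x in at_top. A 0 x \<noteq> 0)"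
    using Suc.prems zero_or_nonzero by blast
  then show ?case
  proof
    assume z: "\<forall>\<^sub>F x in at_top. A 0 x = 0"
    let ?T = "\<lambda>x. \<Sum>i\<le>n. A (Suc i) x * E x ^ i"
    have eq: "\<forall>\<^sub>F x in at_top. ?S x = E x * ?T x"
      using z by eventually_elim
        (simp add: sum.atMost_Suc_shift sum_distrib_left algebra_simps del: sum.atMost_Suc)
    from Suc.IH[of "\<lambda>i. A (Suc i)"] Suc.prems
    have "(\<forall>\<^sub>F x in at_top. ?T x = 0) \<or> (\<forall>\<^sub>F x in at_top. ?T x \<noteq> 0)" by blast
    then show ?thesis
    proof
      assume "\<forall>\<^sub>F x in at_top. ?T x = 0"
      with eq have "\<forall>\<^sub>F x in at_top. ?S x = 0" by eventually_elim simp
      then show ?thesis ..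
    next
      assume "\<forall>\<^sub>F x in at_top. ?T x \<noteq> 0"
      with eq nz have "\<forall>\<^sub>F x in at_top. ?S x \<noteq> 0" by eventually_elim simp
      then show ?thesis ..
    qed
  next
    assume nz0: "\<forall>\<^sub>F x in at_top. A 0 x \<noteq> 0"
    obtain A' where A': "\<And>i. A' i \<in> R"
      and dA: "\<And>i. \<forall>\<^sub>F x in at_top. (A i has_real_derivative A' i x) (at x)"
      using deriv[OF Suc.prems] by metis
    let ?Q = "\<lambda>x. ?S x / A 0 x"
    define B where "B = (\<lambda>i x. A' (Suc i) x * A 0 x + (-1) * (A (Suc i) x * A' 0 x)
                         + real (Suc i) * (g x * (A (Suc i) x * A 0 x)))"
    have B: "B i \<in> R" for i
      unfolding B_def by (intro add mult const Suc.prems A' g)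
    let ?T = "\<lambda>x. \<Sum>i\<le>n. B i x * E x ^ i"
    have dA_all: "\<forall>\<^sub>F x in at_top. \<forall>i\<in>{..Suc n}. (A i has_real_derivative A' i x) (at x)"
      by (rule eventually_ball_finite) (use dA in auto)
    have dQ: "\<forall>\<^sub>F x in at_top. (?Q has_real_derivative E x * ?T x / (A 0 x)\<^sup>2) (at x) \<and> A 0 x \<noteq> 0"
      using dA_all nz0 E'
    proof eventually_elim
      case (elim x)
      have *: "((\<lambda>x. A i x * E x ^ i / A 0 x) has_real_derivative
              (if i = 0 then 0 else B (i - 1) x * E x ^ i / (A 0 x)\<^sup>2)) (at x)" 
        if "i \<le> Suc n" for i
      proof (cases i)
        case 0
        have "((\<lambda>x. A 0 x / A 0 x) has_real_derivative
                (A' 0 x * A 0 x - A 0 x * A' 0 x) / (A 0 x * A 0 x)) (at x)"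
          by (rule DERIV_divide) (use elim in auto)
        then show ?thesis using 0 by simp
      next
        case (Suc j)
        have "((\<lambda>x. A i x * E x ^ i / A 0 x) has_real_derivative
           ((A' i x * E x ^ i + A i x * (real i * (g x * E x) * E x ^ (i - 1))) * A 0 x
             - A i x * E x ^ i * A' 0 x) / (A 0 x)\<^sup>2) (at x)"
          using elim(1)[rule_format, of 0] elim(1)[rule_format, of i] elim(2,3) that
          by (auto intro!: derivative_eq_intros simp: power2_eq_square algebra_simps)
        also have "((A' i x * E x ^ i + A i x * (real i * (g x * E x) * E x ^ (i - 1))) * A 0 x
             - A i x * E x ^ i * A' 0 x) = B (i - 1) x * E x ^ i"
          by (simp add: Suc B_def algebra_simps)
        finally show ?thesis using Suc by simp
      qed
      have "((\<lambda>x. \<Sum>i\<le>Suc n. A i x * E x ^ i / A 0 x) has_real_derivative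
              (\<Sum>i\<le>Suc n. if i = 0 then 0 else B (i - 1) x * E x ^ i / (A 0 x)\<^sup>2)) (at x)"
        by (rule DERIV_sum) (use * in auto)
      also have "(\<Sum>i\<le>Suc n. if i = 0 then 0 else B (i - 1) x * E x ^ i / (A 0 x)\<^sup>2) 
                 = E x * ?T x / (A 0 x)\<^sup>2"
        by (subst sum.atMost_Suc_shift) (simp add: sum_distrib_left sum_divide_distrib algebra_simps)
      finally show ?case using elim(2) by (simp add: sum_divide_distrib del: sum.atMost_Suc)
    qed
    define S T Q where "S = ?S" and "T = ?T" and "Q = (\<lambda>x. S x / A 0 x)"
    have dQ: "\<forall>\<^sub>F x in at_top. (Q has_real_derivative E x * T x / (A 0 x)\<^sup>2) (at x) \<and> A 0 x \<noteq> 0"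
      using dQ unfolding S_def T_def Q_def .
    have "(\<forall>\<^sub>F x in at_top. T x = 0) \<or> (\<forall>\<^sub>F x in at_top. T x \<noteq> 0)"
      unfolding T_def using Suc.IH[of B] B by blast
    then have "(\<forall>\<^sub>F x in at_top. S x = 0) \<or> (\<forall>\<^sub>F x in at_top. S x \<noteq> 0)"
    proof
      assume "\<forall>\<^sub>F x in at_top. T x = 0"
      with dQ have "\<forall>\<^sub>F x in at_top. (Q has_real_derivative 0) (at x) \<and> A 0 x \<noteq> 0" 
        by eventually_elim auto
      then obtain X where X: "\<And>x. x \<ge> X \<Longrightarrow> (Q has_real_derivative 0) (at x)" 
           "\<And>x. x \<ge> X \<Longrightarrow> A 0 x \<noteq> 0"
        by (auto simp: eventually_at_top_linorder)
      have "\<exists>c. \<forall>x\<in>{X..}. Q x = c"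
        by (rule has_field_derivative_zero_constant)
           (use X(1) in \<open>auto intro: has_field_derivative_at_within\<close>)
      then obtain c where c: "\<And>x. x \<ge> X \<Longrightarrow> S x = c * A 0 x"
        using X(2) by (auto simp: Q_def field_simps)
      show ?thesis
      proof (cases "c = 0")
        case True
        then show ?thesis using c by (auto simp: eventually_at_top_linorder)
      next
        case False
        then have "\<forall>\<^sub>F x in at_top. S x \<noteq> 0"
          unfolding eventually_at_top_linorder using c X(2) by (intro exI[of _ X]) auto
        then show ?thesis ..
      qed
    next
      assume "\<forall>\<^sub>F x in at_top. T x \<noteq> 0"
      with dQ nz have "\<forall>\<^sub>F x in at_top. \<exists>y. (Q has_real_derivative y) (at x) \<and> y \<noteq> 0"
      proof eventually_elim
        case (elim x)
        then show ?case by (intro exI[of _ "E x * T x / (A 0 x)\<^sup>2"]) auto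
      qed
      then obtain X where "\<forall>x\<ge>X. \<exists>y. (Q has_real_derivative y) (at x) \<and> y \<noteq> 0"
        unfolding eventually_at_top_linorder ..
      then have X: "\<exists>y. (Q has_real_derivative y) (at x) \<and> y \<noteq> 0" if "x \<ge> X" for x
        using that by blast
      have inj: False if xy: "X \<le> x" "x < y" "Q x = 0" "Q y = 0" for x y
      proof -
        have "\<exists>z>x. z < y \<and> (Q has_real_derivative 0) (at z)"
        proof (rule Rolle)
          show "continuous_on {x..y} Q"
            by (rule continuous_at_imp_continuous_on) 
               (use X xy(1) DERIV_isCont in \<open>meson atLeastAtMost_iff order_trans\<close>)
          show "\<And>z. x < z \<Longrightarrow> z < y \<Longrightarrow> Q differentiable (at z)"
            using X xy(1) by (meson less_imp_le order_trans real_differentiable_def)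
        qed (use xy in auto)
        then show False using X xy(1) DERIV_unique by (meson less_imp_le order_trans)
      qed
      have "\<forall>\<^sub>F x in at_top. Q x \<noteq> 0"
      proof (cases "\<exists>x\<ge>X. Q x = 0")
        case True
        then obtain x where "x \<ge> X" "Q x = 0" by blast
        then show ?thesis using inj unfolding eventually_at_top_dense by blast
      next
        case False
        then show ?thesis unfolding eventually_at_top_linorder by blast
      qed
      then have "\<forall>\<^sub>F x in at_top. S x \<noteq> 0" by eventually_elim (auto simp: Q_def)
      then show ?thesis ..
    qed
    then show ?thesis unfolding S_def .
  qed
qed

text \<open>
  The generator needs only a logarithmic derivative in \<open>R\<close>. This covers powers, whose logarithmic
  derivative is rational, and exponentials of elements of \<open>R\<close>.
\<close>

lemma hardy_ring_adjoin:
  assumes nz: "\<forall>\<^sub>F x in at_top. E x \<noteq> 0"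
    and g: "g \<in> R" and E': "\<forall>\<^sub>F x in at_top. (E has_real_derivative g x * E x) (at x)"
  shows "hardy_ring (adjoin R E)"
proof
  show "(\<lambda>_. c) \<in> adjoin R E" for c
    using const adjoin_superset by blast
next
  fix f h assume "f \<in> adjoin R E" "h \<in> adjoin R E"
  then obtain A B m n where A: "\<And>i. A i \<in> R" "\<And>i. i > m \<Longrightarrow> A i = (\<lambda>_. 0)"
      "f = (\<lambda>x. \<Sum>i\<le>m. A i x * E x ^ i)"
    and B: "\<And>i. B i \<in> R" "\<And>i. i > n \<Longrightarrow> B i = (\<lambda>_. 0)"
      "h = (\<lambda>x. \<Sum>i\<le>n. B i x * E x ^ i)"
    by (auto simp: adjoin_def)
  have f: "f x = (\<Sum>i\<le>m + n. A i x * E x ^ i)" for x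
    unfolding A(3) by (rule sum.mono_neutral_left) (use A(2) in auto)
  have h: "h x = (\<Sum>i\<le>m + n. B i x * E x ^ i)" for x
    unfolding B(3) by (rule sum.mono_neutral_left) (use B(2) in auto)
  show "(\<lambda>x. f x + h x) \<in> adjoin R E" unfolding adjoin_def
    by (rule CollectI, rule exI[of _ "\<lambda>i x. A i x + B i x"], rule exI[of _ "m + n"])
       (use A(1,2) B(1,2) in \<open>auto intro: add simp: f h sum.distrib ring_distribs\<close>)
  have "f x * h x = (\<Sum>r\<le>m + n. (\<Sum>k\<le>r. A k x * B (r - k) x) * E x ^ r)" for x
    unfolding A(3) B(3) by (rule polynomial_product) (use A(2) B(2) in auto)
  moreover have "(\<lambda>x. \<Sum>k\<le>r. A k x * B (r - k) x) = (\<lambda>_. 0)" if "r > m + n" for r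
  proof (intro ext sum.neutral ballI)
    fix x k assume "k \<in> {..r}"
    then have "k > m \<or> r - k > n" using that by auto
    then show "A k x * B (r - k) x = 0" using A(2) B(2) by auto
  qed
  ultimately show "(\<lambda>x. f x * h x) \<in> adjoin R E" unfolding adjoin_def
    by (intro CollectI exI[of _ "\<lambda>r x. \<Sum>k\<le>r. A k x * B (r - k) x"] exI[of _ "m + n"])
       (use A(1) B(1) in \<open>auto intro!: sum mult\<close>)
next
  fix f assume "f \<in> adjoin R E"
  then obtain A n where A: "\<And>i. A i \<in> R" "\<And>i. i > n \<Longrightarrow> A i = (\<lambda>_. 0)"
      "f = (\<lambda>x. \<Sum>i\<le>n. A i x * E x ^ i)"
    by (auto simp: adjoin_def)
  show "(\<forall>\<^sub>F x in at_top. f x = 0) \<or> (\<forall>\<^sub>F x in at_top. f x \<noteq> 0)"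
    unfolding A(3) by (rule adjoin_zero_or_nonzero[OF nz g E']) (fact A(1))
  obtain A' where A': "\<And>i. A' i \<in> R"
    and dA: "\<And>i. \<forall>\<^sub>F x in at_top. (A i has_real_derivative A' i x) (at x)"
    using deriv[OF A(1)] by metis
  define B where "B = (\<lambda>i x. if i \<le> n then A' i x + real i * (g x * A i x) else 0)"
  have "B i \<in> R" for i
    by (cases "i \<le> n") (auto simp: B_def const intro!: add mult A' A g)
  then have "(\<lambda>x. \<Sum>i\<le>n. B i x * E x ^ i) \<in> adjoin R E" unfolding adjoin_def
    by (intro CollectI exI[of _ B] exI[of _ n]) (auto simp: B_def)
  moreover have dA_all: "\<forall>\<^sub>F x in at_top. \<forall>i\<in>{..n}. (A i has_real_derivative A' i x) (at x)"
    by (rule eventually_ball_finite) (use dA in auto)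
  then have "\<forall>\<^sub>F x in at_top. (f has_real_derivative (\<Sum>i\<le>n. B i x * E x ^ i)) (at x)"
    using E'
  proof eventually_elim
    case (elim x)
    have "((\<lambda>x. A i x * E x ^ i) has_real_derivative B i x * E x ^ i) (at x)" if "i \<le> n" for i
    proof -
      have "((\<lambda>x. A i x * E x ^ i) has_real_derivative
              A' i x * E x ^ i + A i x * (real i * (g x * E x) * E x ^ (i - 1))) (at x)"
        using elim(1)[rule_format, of i] elim(2) that
        by (auto intro!: derivative_eq_intros)
      also have "A' i x * E x ^ i + A i x * (real i * (g x * E x) * E x ^ (i - 1)) = B i x * E x ^ i"
        using that by (cases i) (auto simp: B_def algebra_simps)
      finally show ?thesis .
    qed
    then show ?case unfolding A(3) by (intro DERIV_sum) auto
  qed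
  ultimately show "\<exists>h\<in>adjoin R E. \<forall>\<^sub>F x in at_top. (f has_real_derivative h x) (at x)" 
    by (intro bexI[of _ "\<lambda>x. \<Sum>i\<le>n. B i x * E x ^ i"])
qed

lemma adjoin_finitely_many:
  fixes E g :: "nat \<Rightarrow> real \<Rightarrow> real"
  assumes nz: "\<And>k. k < d \<Longrightarrow> \<forall>\<^sub>F x in at_top. E k x \<noteq> 0"
    and g: "\<And>k. k < d \<Longrightarrow> g k \<in> R"
    and E': "\<And>k. k < d \<Longrightarrow> \<forall>\<^sub>F x in at_top. (E k has_real_derivative g k x * E k x) (at x)"
  obtains R' where "hardy_ring R'" "R \<subseteq> R'" "\<And>k. k < d \<Longrightarrow> E k \<in> R'"
proof -
  have "\<exists>R'. hardy_ring R' \<and> R \<subseteq> R' \<and> (\<forall>k<d. E k \<in> R')"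
    using assms
  proof (induction d)
    case 0
    then show ?case using hardy_ring_axioms by blast
  next
    case (Suc d)
    have "\<exists>R'. hardy_ring R' \<and> R \<subseteq> R' \<and> (\<forall>k<d. E k \<in> R')"
      by (rule Suc.IH) (use Suc.prems less_SucI in blast)+
    then obtain R' where R': "hardy_ring R'" "R \<subseteq> R'" "\<forall>k<d. E k \<in> R'"
      by blast
    have "hardy_ring (adjoin R' (E d))"
      by (rule hardy_ring.hardy_ring_adjoin[OF R'(1), where g = "g d"]) (use Suc.prems R'(2) in auto)
    moreover have "R' \<subseteq> adjoin R' (E d)" "E d \<in> adjoin R' (E d)"
      by (rule hardy_ring.adjoin_superset[OF R'(1)], rule hardy_ring.adjoin_generator[OF R'(1)])
    moreover from this R'(3) have "\<forall>k<Suc d. E k \<in> adjoin R' (E d)"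
      by (auto simp: less_Suc_eq)
    ultimately show ?case using R'(2) by (intro exI[of _ "adjoin R' (E d)"]) auto
  qed
  then show thesis using that by blast
qed

end

text \<open>
  Rational functions are identified with their values near infinity, where the default value for
  division by zero does not matter.
\<close>

definition rational_funs :: "(real \<Rightarrow> real) set" where
  "rational_funs = {f. \<exists>p q. q \<noteq> 0 \<and> (\<forall>\<^sub>F x in at_top. f x = poly p x / poly q x)}"

lemma eventually_poly_nonzero:
  fixes p :: "real poly"
  assumes "p \<noteq> 0"
  shows "\<forall>\<^sub>F x in at_top. poly p x \<noteq> 0"
proof -
  have "bdd_above {x. poly p x = 0}" using poly_roots_finite[OF assms] by (rule bdd_above_finite)
  then obtain b where b: "\<And>x. poly p x = 0 \<Longrightarrow> x \<le> b"
    by (auto simp: bdd_above_def)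
  show ?thesis using eventually_gt_at_top[of b] by eventually_elim (use b in force)
qed

lemma poly_in_rational_funs: "(\<lambda>x. poly p x) \<in> rational_funs"
  unfolding rational_funs_def by (rule CollectI, rule exI[of _ p], rule exI[of _ 1]) auto

lemma shifted_reciprocal_in_rational_funs: "(\<lambda>x. c / (x - a)) \<in> rational_funs"
  unfolding rational_funs_def
  by (rule CollectI, rule exI[of _ "[:c:]"], rule exI[of _ "[:-a, 1:]"]) auto

lemma hardy_ring_rational_funs: "hardy_ring rational_funs"
proof
  show "(\<lambda>_. c) \<in> rational_funs" for c
    using poly_in_rational_funs[of "[:c:]"] by simp
next
  fix f g assume "f \<in> rational_funs" "g \<in> rational_funs"
  then obtain p q r s where nz: "q \<noteq> 0" "s \<noteq> 0"
    and f: "\<forall>\<^sub>F x in at_top. f x = poly p x / poly q x"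
    and g: "\<forall>\<^sub>F x in at_top. g x = poly r x / poly s x"
    by (auto simp: rational_funs_def)
  have "\<forall>\<^sub>F x in at_top. f x + g x = poly (p * s + r * q) x / poly (q * s) x"
    using f g eventually_poly_nonzero[OF nz(1)] eventually_poly_nonzero[OF nz(2)]
    by eventually_elim (simp add: field_simps)
  then show "(\<lambda>x. f x + g x) \<in> rational_funs" unfolding rational_funs_def
    using nz by (intro CollectI exI[of _ "p * s + r * q"] exI[of _ "q * s"]) auto
  have "\<forall>\<^sub>F x in at_top. f x * g x = poly (p * r) x / poly (q * s) x"
    using f g by eventually_elim simp
  then show "(\<lambda>x. f x * g x) \<in> rational_funs" unfolding rational_funs_def
    using nz by (intro CollectI exI[of _ "p * r"] exI[of _ "q * s"]) auto
next
  fix f assume "f \<in> rational_funs"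
  then obtain p q where nz: "q \<noteq> 0"
    and f: "\<forall>\<^sub>F x in at_top. f x = poly p x / poly q x"
    by (auto simp: rational_funs_def)
  show "(\<forall>\<^sub>F x in at_top. f x = 0) \<or> (\<forall>\<^sub>F x in at_top. f x \<noteq> 0)"
  proof (cases "p = 0")
    case True
    then show ?thesis using f by auto
  next
    case False
    have "\<forall>\<^sub>F x in at_top. f x \<noteq> 0"
      using f eventually_poly_nonzero[OF nz] eventually_poly_nonzero[OF False]
      by eventually_elim simp
    then show ?thesis ..
  qed
  obtain X where X: "\<And>x. x \<ge> X \<Longrightarrow> f x = poly p x / poly q x" "\<And>x. x \<ge> X \<Longrightarrow> poly q x \<noteq> 0"
    using eventually_conj[OF f eventually_poly_nonzero[OF nz]]
    by (auto simp: eventually_at_top_linorder)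
  let ?h = "\<lambda>x. poly (pderiv p * q - p * pderiv q) x / poly (q * q) x"
  have "(f has_real_derivative ?h x) (at x)" if "x > X" for x
  proof -
    have "((\<lambda>x. poly p x / poly q x) has_real_derivative ?h x) (at x)"
      using X(2)[of x] that by (auto intro!: derivative_eq_intros poly_DERIV)
    moreover have "\<forall>\<^sub>F y in nhds x. f y = poly p y / poly q y"
      using eventually_nhds_in_open[of "{X<..}" x] that by (auto elim!: eventually_mono simp: X)
    ultimately show ?thesis by (subst DERIV_cong_ev[OF refl _ refl])
  qed
  then have "\<forall>\<^sub>F x in at_top. (f has_real_derivative ?h x) (at x)"
    unfolding eventually_at_top_dense by blast
  moreover have "?h \<in> rational_funs" unfolding rational_funs_def
    using nz by (intro CollectI exI[of _ "pderiv p * q - p * pderiv q"] exI[of _ "q * q"]) auto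
  ultimately show "\<exists>h\<in>rational_funs. \<forall>\<^sub>F x in at_top. (f has_real_derivative h x) (at x)"
    by (intro bexI[of _ ?h])
qed

text \<open>
  Starting from the rational functions, adjoin the powers \<open>(x - k)\<^sup>\<theta>\<close> and then the exponentials
  \<open>exp (c (x - k)\<^sup>\<theta>)\<close>. The sum lies in the resulting ring, so it cannot have arbitrarily large
  zeros without vanishing near infinity.
\<close>

lemma exp_power_sum_eventually_zero:
  fixes c \<theta> :: real and p :: "nat \<Rightarrow> real poly"
  assumes zeros: "\<And>n. n \<ge> N \<Longrightarrow> (\<Sum>k<d. poly (p k) (real n) * exp (c * (real n - real k) powr \<theta>)) = 0"
  shows "\<forall>\<^sub>F x in at_top. (\<Sum>k<d. poly (p k) x * exp (c * (x - real k) powr \<theta>)) = 0"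
proof -
  interpret hardy_ring rational_funs by (rule hardy_ring_rational_funs)
  obtain R1 where R1: "hardy_ring R1" "rational_funs \<subseteq> R1" 
      "\<And>k. k < d \<Longrightarrow> (\<lambda>x. (x - real k) powr \<theta>) \<in> R1"
  proof (rule adjoin_finitely_many[of d "\<lambda>k x. (x - real k) powr \<theta>" "\<lambda>k x. \<theta> / (x - real k)"])
    fix k
    show "\<forall>\<^sub>F x in at_top. (x - real k) powr \<theta> \<noteq> 0"
      using eventually_gt_at_top[of "real k"] by eventually_elim auto
    show "\<forall>\<^sub>F x in at_top. ((\<lambda>x. (x - real k) powr \<theta>) has_real_derivative
             \<theta> / (x - real k) * (x - real k) powr \<theta>) (at x)"
      using eventually_gt_at_top[of "real k"] 
      by eventually_elim (auto intro!: derivative_eq_intros simp: powr_diff field_simps)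
  qed (auto intro: shifted_reciprocal_in_rational_funs)
  interpret R1: hardy_ring R1 by (fact R1(1))
  obtain R2 where R2: "hardy_ring R2" "R1 \<subseteq> R2" 
      "\<And>k. k < d \<Longrightarrow> (\<lambda>x. exp (c * (x - real k) powr \<theta>)) \<in> R2"
  proof (rule R1.adjoin_finitely_many[of d "\<lambda>k x. exp (c * (x - real k) powr \<theta>)"
        "\<lambda>k x. (c * \<theta>) / (x - real k) * (x - real k) powr \<theta>"])
    fix k assume "k < d"
    then show "(\<lambda>x. (c * \<theta>) / (x - real k) * (x - real k) powr \<theta>) \<in> R1"
      by (intro R1.mult R1(3)) (use R1(2) shifted_reciprocal_in_rational_funs in blast)+
    show "\<forall>\<^sub>F x in at_top. ((\<lambda>x. exp (c * (x - real k) powr \<theta>)) has_real_derivative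
             (c * \<theta>) / (x - real k) * (x - real k) powr \<theta> * exp (c * (x - real k) powr \<theta>)) (at x)"
      using eventually_gt_at_top[of "real k"] 
      by eventually_elim (auto intro!: derivative_eq_intros simp: powr_diff field_simps)
  qed auto
  interpret R2: hardy_ring R2 by (fact R2(1))
  let ?F = "\<lambda>x. \<Sum>k<d. poly (p k) x * exp (c * (x - real k) powr \<theta>)"
  have "?F \<in> R2"
    by (intro R2.sum R2.mult R2(3)) (use R1(2) R2(2) poly_in_rational_funs in blast)+
  moreover have "\<not> (\<forall>\<^sub>F x in at_top. ?F x \<noteq> 0)"
  proof
    assume "\<forall>\<^sub>F x in at_top. ?F x \<noteq> 0"
    then obtain X where "\<And>x. x \<ge> X \<Longrightarrow> ?F x \<noteq> 0" by (auto simp: eventually_at_top_linorder)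
    moreover obtain n where "n \<ge> N" "real n \<ge> X"
      by (metis nat_le_linear of_nat_le_iff order_trans real_arch_simple)
    ultimately show False using zeros by blast
  qed
  ultimately show ?thesis using R2.zero_or_nonzero by blast
qed

section \<open>Exponentials of powers\<close>

lemma powr_times_exp_neg_tendsto_0:
  fixes a q :: real
  assumes "a > 0"
  shows "((\<lambda>y. y powr q * exp (- (a * y))) \<longlongrightarrow> 0) at_top"
  using assms by real_asymp


text \<open>
  Since \<open>(n - j)\<^sup>\<theta> - (n - i)\<^sup>\<theta> \<ge> (n - i)\<^sup>\<theta>\<^sup>-\<^sup>1\<close> for \<open>j < i < n\<close>, the shifts lie on separated scales: the
  smallest shift dominates for \<open>c > 0\<close> and the largest one for \<open>c < 0\<close>. This is why the ranking of the scales
  carries the sign \<open>s\<close>.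
\<close>

lemma not_holonomic_exp_power_greater_1:
  fixes c \<theta> :: real
  assumes c: "c \<noteq> 0" and \<theta>: "\<theta> > 1"
  shows "\<not> holonomic_from m (\<lambda>n. of_real (exp (c * real n powr \<theta>)))"
proof (rule not_holonomic_fromI)
  fix d :: nat and p :: "nat \<Rightarrow> complex poly"
  let ?f = "\<lambda>n. complex_of_real (exp (c * real n powr \<theta>))"
  assume rec: "\<forall>\<^sub>F n in sequentially. (\<Sum>k\<le>d. poly (p k) (of_nat n) * ?f (n - k)) = 0"
  have decay: "(\<lambda>n. real n ^ l * exp (- (\<bar>c\<bar> * real (n - i) powr (\<theta> - 1)))) \<longlonglongrightarrow> 0" for l i
  proof -
    have "filterlim (\<lambda>n. real n powr (\<theta> - 1)) at_top sequentially"
      using \<theta> by real_asymp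
    from filterlim_compose[OF powr_times_exp_neg_tendsto_0[of "\<bar>c\<bar>" "real l / (\<theta> - 1)"] this]
    have "(\<lambda>n. (real n powr (\<theta> - 1)) powr (real l / (\<theta> - 1)) * exp (- (\<bar>c\<bar> * real n powr (\<theta> - 1)))) \<longlonglongrightarrow> 0"
      using c by simp
    then have "(\<lambda>n. real n powr real l * exp (- (\<bar>c\<bar> * real n powr (\<theta> - 1)))) \<longlonglongrightarrow> 0"
      using \<theta> by (simp add: powr_powr)
    then have "(\<lambda>n. 2 ^ l * (real n powr real l * exp (- (\<bar>c\<bar> * real n powr (\<theta> - 1))))) \<longlonglongrightarrow> 2 ^ l * 0"
      by (intro tendsto_intros)
    then have lim: "(\<lambda>n. 2 ^ l * (real n powr real l * exp (- (\<bar>c\<bar> * real n powr (\<theta> - 1))))) \<longlonglongrightarrow> 0" by simp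
    have "(\<lambda>n. real (n + i) ^ l * exp (- (\<bar>c\<bar> * real n powr (\<theta> - 1)))) \<longlonglongrightarrow> 0"
    proof (rule Lim_null_comparison[OF _ lim])
      show "\<forall>\<^sub>F n in sequentially. norm (real (n + i) ^ l * exp (- (\<bar>c\<bar> * real n powr (\<theta> - 1))))
           \<le> 2 ^ l * (real n powr real l * exp (- (\<bar>c\<bar> * real n powr (\<theta> - 1))))"
        using eventually_ge_at_top[of "Suc i"]
      proof eventually_elim
        case (elim n)
        have "real (n + i) ^ l \<le> (2 * real n) ^ l" using elim by (intro power_mono) auto
        also have "\<dots> = 2 ^ l * real n powr real l" using elim by (simp add: power_mult_distrib powr_realpow)
        finally show ?case by (simp add: mult_right_mono flip: mult.assoc)
      qed
    qed
    then show ?thesis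
      using LIMSEQ_offset[where k = i and f = "\<lambda>n. real n ^ l * exp (- (\<bar>c\<bar> * real (n - i) powr (\<theta> - 1)))"]
      by simp
  qed
  have split: "x powr \<theta> = x * x powr (\<theta> - 1)" if "x \<ge> 0" for x :: real
    using that by (simp add: powr_mult_base)
  have gap: "real (n - i) powr (\<theta> - 1) \<le> real (n - j) powr \<theta> - real (n - i) powr \<theta>" if "j < i" "i < n" for i j n
  proof -
    have "real (n - i) powr \<theta> + real (n - i) powr (\<theta> - 1) = (real (n - i) + 1) * real (n - i) powr (\<theta> - 1)"
      by (simp only: split[of "real (n - i)", OF of_nat_0_le_iff] ring_distribs mult_1)
    also have "\<dots> \<le> real (n - j) * real (n - j) powr (\<theta> - 1)"
      using that \<theta> by (intro mult_mono powr_mono2) auto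
    also have "\<dots> = real (n - j) powr \<theta>"
      by (rule split[symmetric]) simp
    finally show ?thesis by (simp only: le_diff_eq add.commute)
  qed
  define s :: int where "s = (if c > 0 then -1 else 1)"
  show "\<forall>k\<le>d. p k = 0"
  proof (intro allI impI)
    fix k assume k: "k \<le> d"
    show "p k = 0"
    proof (rule separated_scales[of "{..d}" "\<lambda>k. s * int k" "\<lambda>k n. ?f (n - k)" "\<lambda>_. 0" p])
      show "inj_on (\<lambda>k. s * int k) {..d}" by (auto simp: s_def inj_on_def)
      fix i j :: nat assume "s * int i < s * int j"
      then have ij: "(c > 0 \<and> j < i) \<or> (c < 0 \<and> i < j)" using c by (auto simp: s_def split: if_splits)
      show "negligible (\<lambda>n. ?f (n - i)) (\<lambda>n. ?f (n - j))"
        unfolding negligible_def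
      proof
        fix l
        show "(\<lambda>n. of_nat n ^ l * (?f (n - i) / ?f (n - j))) \<longlonglongrightarrow> 0"
        proof (rule Lim_null_comparison[OF _ decay[of l "max i j"]])
          show "\<forall>\<^sub>F n in sequentially. norm (of_nat n ^ l * (?f (n - i) / ?f (n - j)))
              \<le> real n ^ l * exp (- (\<bar>c\<bar> * real (n - max i j) powr (\<theta> - 1)))"
            using eventually_gt_at_top[of "max i j"]
          proof eventually_elim
            case (elim n)
            have "c * real (n - i) powr \<theta> - c * real (n - j) powr \<theta> \<le> - (\<bar>c\<bar> * real (n - max i j) powr (\<theta> - 1))"
              using ij
            proof
              assume ij: "c > 0 \<and> j < i"
              then have "c * real (n - i) powr (\<theta> - 1) \<le> c * (real (n - j) powr \<theta> - real (n - i) powr \<theta>)"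
                using elim by (intro mult_left_mono gap[of j i n]) simp_all
              then show ?thesis using ij by (simp add: max_def algebra_simps)
            next
              assume ij: "c < 0 \<and> i < j"
              then have "- c * real (n - j) powr (\<theta> - 1) \<le> - c * (real (n - i) powr \<theta> - real (n - j) powr \<theta>)"
                using elim by (intro mult_left_mono gap[of i j n]) simp_all
              then show ?thesis using ij by (simp add: max_def algebra_simps)
            qed
            moreover have "norm (?f (n - i) / ?f (n - j)) = exp (c * real (n - i) powr \<theta> - c * real (n - j) powr \<theta>)"
              by (simp add: norm_divide exp_diff)
            ultimately have "norm (?f (n - i) / ?f (n - j)) \<le> exp (- (\<bar>c\<bar> * real (n - max i j) powr (\<theta> - 1)))"
              by (simp only: exp_le_cancel_iff)
            then show ?case
              unfolding norm_mult norm_power norm_of_nat by (rule mult_left_mono) simp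
          qed
        qed
      qed
    qed (use rec k in \<open>auto simp: negligible_0\<close>)
  qed
qed


lemma zero_on_real_interval_imp_zero:
  fixes f :: "complex \<Rightarrow> complex"
  assumes f: "f holomorphic_on S" "open S" "connected S" and ab: "a < b"
    and zero: "\<And>y. a < y \<Longrightarrow> y < b \<Longrightarrow> of_real y \<in> S \<and> f (of_real y) = 0"
    and w: "w \<in> S"
  shows "f w = 0"
proof (rule analytic_continuation[OF f(1-3), of "of_real ` {a<..<b}" "of_real ((a + b) / 2)"])
  show "complex_of_real ((a + b) / 2) islimpt of_real ` {a<..<b}"
    unfolding islimpt_approachable
  proof (intro allI impI)
    fix e :: real assume e: "e > 0"
    define y where "y = (a + b) / 2 + min (e / 2) ((b - a) / 4)"
    have y: "a < y" "y < b" "y \<noteq> (a + b) / 2" "\<bar>y - (a + b) / 2\<bar> < e"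
      using e ab by (auto simp: y_def min_def field_simps)
    have "dist (complex_of_real y) (of_real ((a + b) / 2)) < e"
      using y(4) unfolding dist_norm by (metis of_real_diff norm_of_real)
    then show "\<exists>x'\<in>of_real ` {a<..<b}. x' \<noteq> complex_of_real ((a + b) / 2) \<and> dist x' (of_real ((a + b) / 2)) < e"
      using y(1-3) by (intro bexI[of _ "of_real y"]) (auto simp del: of_real_divide of_real_add)
  qed
qed (use ab zero[of "(a + b) / 2"] zero w in auto)

text \<open>
  The half-plane \<open>Re z > D\<close> avoids the branch cuts of all the powers \<open>(z - k)\<^sup>\<theta>\<close> with \<open>k \<le> D\<close>.
\<close>

lemma exp_power_sum_continues:
  fixes p :: "nat \<Rightarrow> complex poly" and c \<theta> :: real
  assumes ev: "\<forall>\<^sub>F x in at_top. (\<Sum>k\<le>D. poly (p k) (of_real x) * of_real (exp (c * (x - real k) powr \<theta>))) = 0"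
    and z: "Re z > real D"
  shows "(\<Sum>k\<le>D. poly (p k) z * exp (of_real c * (z - of_nat k) powr of_real \<theta>)) = 0"
proof -
  obtain X where X: "\<And>x. x \<ge> X \<Longrightarrow> (\<Sum>k\<le>D. poly (p k) (of_real x) * of_real (exp (c * (x - real k) powr \<theta>))) = 0"
    using ev unfolding eventually_at_top_linorder by blast
  show ?thesis
  proof (rule zero_on_real_interval_imp_zero[where S = "{z. Re z > real D}" and w = z and
        f = "\<lambda>z. \<Sum>k\<le>D. poly (p k) z * exp (of_real c * (z - of_nat k) powr of_real \<theta>)" and
        a = "max X (real D)" and b = "max X (real D) + 1"])
    show "(\<lambda>z. \<Sum>k\<le>D. poly (p k) z * exp (of_real c * (z - of_nat k) powr of_real \<theta>)) holomorphic_on {z. Re z > real D}"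
      by (intro holomorphic_intros) (auto simp: complex_nonpos_Reals_iff)
    show "open {z. Re z > real D}" by (rule open_halfspace_Re_gt)
    show "connected {z. Re z > real D}" by (intro convex_connected convex_halfspace_Re_gt)
  next
    fix y assume y: "max X (real D) < y" 
    have "(\<Sum>k\<le>D. poly (p k) (of_real y) * exp (of_real c * (of_real y - of_nat k) powr of_real \<theta>)) =
          (\<Sum>k\<le>D. poly (p k) (of_real y) * of_real (exp (c * (y - real k) powr \<theta>)))"
    proof (rule sum.cong[OF refl])
      fix k assume "k \<in> {..D}"
      then have "(complex_of_real (y - real k)) powr of_real \<theta> = of_real ((y - real k) powr \<theta>)"
        using y by (intro powr_of_real) auto
      then show "poly (p k) (of_real y) * exp (of_real c * (of_real y - of_nat k) powr of_real \<theta>) =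
            poly (p k) (of_real y) * of_real (exp (c * (y - real k) powr \<theta>))"
        by (simp flip: exp_of_real)
    qed
    then show "of_real y \<in> {z. Re z > real D} \<and> 
         (\<Sum>k\<le>D. poly (p k) (of_real y) * exp (of_real c * (of_real y - of_nat k) powr of_real \<theta>)) = 0"
      using X[of y] y by simp
  qed (use z in auto)
qed

text \<open>
  At \<open>z = D + w\<close> the summands with \<open>k < D\<close> are analytic for \<open>\<bar>w\<bar> < 1\<close>, and their sum gives \<open>- G\<close>. In the last
  summand the coordinate \<open>w = exp t\<close> replaces the multivalued \<open>w\<^sup>\<theta>\<close> by the entire function
  \<open>exp (\<theta> t)\<close>. The relation holds first for real \<open>t\<close> and then on the whole half-plane \<open>Re t < 0\<close>,
  in particular for values of \<open>t\<close> that differ by \<open>2 \<pi> \<i>\<close>.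
\<close>

lemma exp_power_sum_singular_term:
  fixes p :: "nat \<Rightarrow> complex poly" and c \<theta> :: real
  assumes ev: "\<forall>\<^sub>F x in at_top. (\<Sum>k\<le>D. poly (p k) (of_real x) * of_real (exp (c * (x - real k) powr \<theta>))) = 0"
    and nz: "p D \<noteq> 0"
  obtains Q G where "Q \<noteq> 0" "G holomorphic_on ball 0 1"
    "\<And>t. Re t < 0 \<Longrightarrow> poly Q (exp t) * exp (of_real c * exp (of_real \<theta> * t)) = G (exp t)"
proof -
  define Q where "Q = pcompose (p D) [:of_nat D, 1:]"
  define G where "G = (\<lambda>w. - (\<Sum>k<D. poly (p k) (w + of_nat D) * exp (of_real c * (w + of_nat D - of_nat k) powr of_real \<theta>)))"
  have "Q \<noteq> 0" unfolding Q_def using nz by (simp add: pcompose_eq_0_iff)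
  have G: "G holomorphic_on ball 0 1"
    unfolding G_def
  proof (intro holomorphic_intros)
    fix k w assume kw: "k \<in> {..<D}" "w \<in> ball (0::complex) 1"
    have "\<bar>Re w\<bar> < 1" using kw(2) abs_Re_le_cmod[of w] by simp
    moreover have "real D - real k \<ge> 1" using kw(1) by (simp add: Suc_le_eq)
    ultimately have "Re (w + of_nat D - of_nat k) > 0" by simp
    then show "w + of_nat D - of_nat k \<notin> \<real>\<^sub>\<le>\<^sub>0" by (auto simp: complex_nonpos_Reals_iff)
  qed
  have norm_exp_lt: "exp t \<in> ball (0::complex) 1" if "Re t < 0" for t using that by simp
  define \<Phi> where "\<Phi> = (\<lambda>t. poly Q (exp t) * exp (of_real c * exp (of_real \<theta> * t)) - G (exp t))"
  have \<Phi>: "\<Phi> t = 0" if "Re t < 0" for t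
  proof (rule zero_on_real_interval_imp_zero[where f = \<Phi> and w = t and S = "{t. Re t < 0}" and a = "-2" and b = "-1"])
    have "(G \<circ> exp) holomorphic_on {t. Re t < 0}"
      by (rule holomorphic_on_compose_gen[OF holomorphic_on_exp G]) (use norm_exp_lt in auto)
    then show "\<Phi> holomorphic_on {t. Re t < 0}"
      unfolding \<Phi>_def o_def by (intro holomorphic_intros)
    show "open {t. Re t < 0}" by (rule open_halfspace_Re_lt)
    show "connected {t. Re t < 0}" by (intro convex_connected convex_halfspace_Re_lt)
  next
    fix y :: real assume y: "y < -1"
    let ?w = "exp (complex_of_real y)"
    have w: "?w = of_real (exp y)" by (simp add: exp_of_real)
    have "(\<Sum>k\<le>D. poly (p k) (?w + of_nat D) * exp (of_real c * (?w + of_nat D - of_nat k) powr of_real \<theta>)) = 0"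
      by (rule exp_power_sum_continues[OF ev]) (simp add: w)
    moreover have "?w powr of_real \<theta> = exp (of_real \<theta> * of_real y)"
      unfolding w by (subst powr_of_real) (auto simp: exp_of_real powr_def simp flip: of_real_mult)
    ultimately have "poly (p D) (?w + of_nat D) * exp (of_real c * exp (of_real \<theta> * of_real y)) = G ?w"
      unfolding G_def by (simp add: lessThan_Suc_atMost[symmetric] eq_neg_iff_add_eq_0 add.commute)
    then show "of_real y \<in> {t. Re t < 0} \<and> \<Phi> (of_real y) = 0"
      using y by (simp add: \<Phi>_def Q_def poly_pcompose add.commute)
  qed (use that in auto)
  show ?thesis
    by (rule that[OF \<open>Q \<noteq> 0\<close> G]) (use \<Phi> in \<open>simp add: \<Phi>_def\<close>)
qed

text \<open>
  The right-hand side has period \<open>2 \<pi> \<i>\<close>. Hence \<open>exp (\<kappa> exp (\<theta> t)) = 1\<close> for a constant \<open>\<kappa>\<close>, which is nonzero because \<open>\<theta>\<close> is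
  not an integer, as soon as \<open>Q (exp t) \<noteq> 0\<close>. But \<open>exp (\<theta> t)\<close> is small and nonzero when \<open>Re t\<close> is very negative,
  and the exponential function takes the value \<open>1\<close> at no small nonzero point.
\<close>

lemma exp_power_not_single_valued:
  fixes Q :: "complex poly" and c \<theta> :: real
  assumes eq: "\<And>t. Re t < 0 \<Longrightarrow> poly Q (exp t) * exp (of_real c * exp (of_real \<theta> * t)) = G (exp t)"
    and Q: "Q \<noteq> 0" and c: "c \<noteq> 0" and \<theta>: "0 < \<theta>" "\<theta> < 1"
  shows False
proof -
  define \<kappa> where "\<kappa> = of_real c * (1 - exp (2 * of_real pi * \<i> * of_real \<theta>))"
  have "exp (2 * of_real pi * \<i> * of_real \<theta>) \<noteq> 1"
  proof
    assume "exp (2 * of_real pi * \<i> * of_real \<theta>) = 1"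
    then obtain n :: int where "2 * pi * \<theta> = of_int (2 * n) * pi" by (auto simp: exp_eq_1)
    then have "\<theta> = of_int n" by simp
    then show False using \<theta> by simp
  qed
  then have \<kappa>: "\<kappa> \<noteq> 0" using c by (simp add: \<kappa>_def)
  obtain \<delta> where \<delta>: "\<delta> > 0" "\<And>w. poly Q w = 0 \<Longrightarrow> w \<noteq> 0 \<Longrightarrow> \<delta> \<le> dist 0 w"
    using finite_set_avoid[OF poly_roots_finite[OF Q], of 0] by auto
  \<comment> \<open>The point \<open>s = exp t\<close> is so close to \<open>0\<close> that \<open>Q s \<noteq> 0\<close> and \<open>\<bar>\<kappa>\<bar> s\<^sup>\<theta> < 1\<close>.\<close>
  define s where "s = min (\<delta> / 2) (min (1 / 2) ((1 / (norm \<kappa> + 1)) powr (1 / \<theta>)))"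
  have pos: "norm \<kappa> + 1 > 0" using norm_ge_zero[of \<kappa>] by linarith
  then have s: "0 < s" "s < \<delta>" "s < 1" "s \<le> (1 / (norm \<kappa> + 1)) powr (1 / \<theta>)"
    using \<delta>(1) by (auto simp: s_def min_def)
  define t where "t = complex_of_real (ln s)"
  have exp_t: "exp t = of_real s" using s(1) by (simp add: t_def exp_of_real)
  have t: "Re t < 0" "Re (t + 2 * of_real pi * \<i>) < 0" using s(1,3) by (auto simp: t_def)
  have "exp (t + 2 * of_real pi * \<i>) = exp t" by (simp add: exp_add)
  with eq[OF t(1)] eq[OF t(2)]
  have "poly Q (exp t) * exp (of_real c * exp (of_real \<theta> * t)) =
        poly Q (exp t) * exp (of_real c * exp (of_real \<theta> * (t + 2 * of_real pi * \<i>)))" by simp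
  moreover have "poly Q (exp t) \<noteq> 0" using \<delta>(2)[of "exp t"] s by (auto simp: exp_t)
  ultimately have "exp (of_real c * exp (of_real \<theta> * t)) =
         exp (of_real c * exp (of_real \<theta> * (t + 2 * of_real pi * \<i>)))" by simp
  then have "exp (of_real c * exp (of_real \<theta> * t) - 
         of_real c * exp (of_real \<theta> * (t + 2 * of_real pi * \<i>))) = 1"
    by (simp add: exp_diff)
  moreover have "of_real c * exp (of_real \<theta> * t) - of_real c * exp (of_real \<theta> * (t + 2 * of_real pi * \<i>))
      = \<kappa> * of_real (s powr \<theta>)"
    using s(1) by (simp add: \<kappa>_def t_def powr_def exp_add algebra_simps exp_of_real[symmetric])
  ultimately have "exp (\<kappa> * of_real (s powr \<theta>)) = 1" by simp
  then obtain n :: int where n: "Re (\<kappa> * of_real (s powr \<theta>)) = 0" "Im (\<kappa> * of_real (s powr \<theta>)) = of_int (2 * n) * pi"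
    unfolding exp_eq_1 by blast
  have "s powr \<theta> \<le> ((1 / (norm \<kappa> + 1)) powr (1 / \<theta>)) powr \<theta>"
    using s \<theta> by (intro powr_mono2) auto
  also have "\<dots> = 1 / (norm \<kappa> + 1)" using \<theta> less_imp_le[OF pos] by (simp add: powr_powr)
  finally have "norm \<kappa> * s powr \<theta> \<le> norm \<kappa> * (1 / (norm \<kappa> + 1))" by (intro mult_left_mono) auto
  also have "\<dots> < 1" using pos by (simp add: pos_divide_less_eq)
  finally have "norm (\<kappa> * of_real (s powr \<theta>)) < 1" by (simp add: norm_mult)
  then have "\<bar>Im (\<kappa> * of_real (s powr \<theta>))\<bar> < 1" by (rule order.strict_trans1[OF abs_Im_le_cmod])
  then have lt: "\<bar>of_int (2 * n) * pi\<bar> < 1" unfolding n(2) .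
  have "n = 0"
  proof (rule ccontr)
    assume "n \<noteq> 0"
    then have "\<bar>real_of_int (2 * n)\<bar> \<ge> 1" by linarith
    moreover have "pi \<ge> 1" using pi_gt3 by simp
    ultimately have "\<bar>real_of_int (2 * n)\<bar> * pi \<ge> 1 * 1" by (intro mult_mono) auto
    then show False using lt by (simp add: abs_mult)
  qed
  then have "\<kappa> * of_real (s powr \<theta>) = 0" using n by (simp add: complex_eq_iff)
  then show False using \<kappa> s(1) by simp
qed

text \<open>
  Choose the imaginary part \<open>\<phi>\<close> of \<open>t\<close> such that \<open>c exp (\<theta> t)\<close> is real and positive, hence equal
  to \<open>\<bar>c\<bar> s\<^sup>\<theta>\<close> for \<open>s = \<bar>exp t\<bar>\<close>. As \<open>s\<close> tends to \<open>0\<close>, the exponential grows faster than every negative power of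
  \<open>s\<close>, whereas \<open>Q\<close> has only a zero of finite order \<open>m\<close> at \<open>0\<close> and \<open>G\<close> is bounded there.
\<close>

lemma exp_negative_power_unbounded:
  fixes Q :: "complex poly" and c \<theta> :: real
  assumes eq: "\<And>t. Re t < 0 \<Longrightarrow> poly Q (exp t) * exp (of_real c * exp (of_real \<theta> * t)) = G (exp t)"
    and G: "G holomorphic_on ball 0 1"
    and Q: "Q \<noteq> 0" and c: "c \<noteq> 0" and \<theta>: "\<theta> < 0"
  shows False
proof -
  define m where "m = order 0 Q"
  obtain Q1 where Q1: "Q = [:0, 1:] ^ m * Q1" "poly Q1 0 \<noteq> 0"
    using order_decomp[OF Q, of 0] by (auto simp: m_def poly_eq_0_iff_dvd)
  have "continuous (at 0) G" 
    using G by (meson holomorphic_on_imp_continuous_on continuous_on_eq_continuous_at open_ball centre_in_ball zero_less_one)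
  moreover have "continuous (at 0) (poly Q1)" by (intro continuous_intros)
  ultimately have *: "(\<lambda>w. norm (G w)) \<midarrow>0\<rightarrow> norm (G 0)" "(\<lambda>w. norm (poly Q1 w)) \<midarrow>0\<rightarrow> norm (poly Q1 0)"
    by (auto simp: continuous_at intro: tendsto_norm)
  have "\<forall>\<^sub>F w in at 0. norm (G w) < norm (G 0) + 1" 
    using order_tendstoD(2)[OF *(1)] by simp
  moreover have "\<forall>\<^sub>F w in at 0. norm (poly Q1 w) > norm (poly Q1 0) / 2"
    by (rule order_tendstoD(1)[OF *(2)]) (use Q1(2) in simp)
  ultimately have "\<forall>\<^sub>F w in at 0. norm (G w) < norm (G 0) + 1 \<and> norm (poly Q1 w) > norm (poly Q1 0) / 2"
    by (rule eventually_conj)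
  then obtain \<delta> where \<delta>: "\<delta> > 0" "\<And>w. w \<noteq> 0 \<Longrightarrow> norm w < \<delta> \<Longrightarrow> norm (G w) < norm (G 0) + 1"
      "\<And>w. w \<noteq> 0 \<Longrightarrow> norm w < \<delta> \<Longrightarrow> norm (poly Q1 w) > norm (poly Q1 0) / 2"
    unfolding eventually_at by auto
  define B where "B = norm (G 0) + 1"
  define K where "K = norm (poly Q1 0) / 2"
  have K: "K > 0" and B: "B > 0" using Q1(2) by (auto simp: K_def B_def add_nonneg_pos)
  define \<phi> where "\<phi> = (if c > 0 then 0 else pi / \<theta>)"
  have upper: "K * s ^ m * exp (\<bar>c\<bar> * s powr \<theta>) \<le> B" if s: "0 < s" "s < \<delta>" "s < 1" for s
  proof -
    define t where "t = Complex (ln s) \<phi>"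
    have t: "Re t < 0" "norm (exp t) = s" using s by (auto simp: t_def)
    have "Im (of_real \<theta> * t) = (if c > 0 then 0 else pi)" using \<theta> by (auto simp: t_def \<phi>_def)
    then have "exp (of_real \<theta> * t) = (if c > 0 then 1 else -1) * of_real (s powr \<theta>)"
      using s by (auto simp: exp_eq_polar cis_pi t_def powr_def)
    then have "of_real c * exp (of_real \<theta> * t) = of_real (\<bar>c\<bar> * s powr \<theta>)" using c by auto
    then have e: "norm (exp (of_real c * exp (of_real \<theta> * t))) = exp (\<bar>c\<bar> * s powr \<theta>)" by simp
    have "K * s ^ m \<le> norm (poly Q (exp t))"
      using \<delta>(3)[of "exp t"] t s by (simp add: Q1(1) norm_mult norm_power K_def mult.commute)
    then have "K * s ^ m * exp (\<bar>c\<bar> * s powr \<theta>) \<le> norm (poly Q (exp t)) * exp (\<bar>c\<bar> * s powr \<theta>)"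
      by (rule mult_right_mono) simp
    also have "\<dots> = norm (G (exp t))" using eq[OF t(1)] e by (metis norm_mult)
    also have "\<dots> \<le> B" using \<delta>(2)[of "exp t"] t s by (simp add: B_def)
    finally show ?thesis .
  qed
  \<comment> \<open>In the variable \<open>y = s powr \<theta>\<close>, which tends to infinity, \<open>s ^ m\<close> becomes \<open>y powr - q\<close>.\<close>
  define q where "q = - real m / \<theta>"
  have "((\<lambda>y. y powr q * exp (- (\<bar>c\<bar> * y))) \<longlongrightarrow> 0) at_top"
    using c by (intro powr_times_exp_neg_tendsto_0) simp
  then have "\<forall>\<^sub>F y in at_top. y powr q * exp (- (\<bar>c\<bar> * y)) < K / B"
    using K B by (intro order_tendstoD(2)) auto
  moreover have "((\<lambda>y. y powr (1 / \<theta>)) \<longlongrightarrow> 0) at_top"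
    using \<theta> by (intro tendsto_neg_powr filterlim_ident) simp
  then have "\<forall>\<^sub>F y in at_top. y powr (1 / \<theta>) < min \<delta> 1"
    using \<delta>(1) by (intro order_tendstoD(2)) auto
  moreover have "\<forall>\<^sub>F y::real in at_top. y > 0" by (rule eventually_gt_at_top)
  ultimately have "\<forall>\<^sub>F y::real in at_top. False"
  proof eventually_elim
    case (elim y)
    define s where "s = y powr (1 / \<theta>)"
    have "s powr \<theta> = y" using elim \<theta> by (simp add: s_def powr_powr)
    moreover have "s ^ m = y powr (- q)" 
      using elim by (simp add: s_def q_def powr_powr flip: powr_realpow)
    ultimately have "K * y powr (- q) * exp (\<bar>c\<bar> * y) \<le> B" using upper[of s] elim by (simp add: s_def)
    then have "K / B \<le> y powr q * exp (- (\<bar>c\<bar> * y))"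
      using elim(3) B by (simp add: powr_minus exp_minus field_simps)
    then show False using elim(1) by simp
  qed
  then show False by simp
qed

lemma Re_poly_of_real: "Re (poly p (of_real x)) = poly (map_poly Re p) x"
  by (induction p) (auto simp: map_poly_pCons)

lemma Im_poly_of_real: "Im (poly p (of_real x)) = poly (map_poly Im p) x"
  by (induction p) (auto simp: map_poly_pCons)

text \<open>
  Let \<open>D\<close> be the largest shift that occurs in the recurrence. The real and imaginary parts of the
  coefficients give two real relations, to which the zero count applies.
\<close>

lemma not_holonomic_exp_power_less_1:
  fixes c \<theta> :: real
  assumes c: "c \<noteq> 0" and \<theta>: "\<theta> < 1" "\<theta> \<noteq> 0"
  shows "\<not> holonomic_from m (\<lambda>n. of_real (exp (c * real n powr \<theta>)))"
proof (rule not_holonomic_fromI, rule ccontr)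
  fix d :: nat and p :: "nat \<Rightarrow> complex poly"
  assume "\<not> (\<forall>k\<le>d. p k = 0)"
  define D where "D = Max {k. k \<le> d \<and> p k \<noteq> 0}"
  have fin: "finite {k. k \<le> d \<and> p k \<noteq> 0}" by simp
  have D: "D \<le> d" "p D \<noteq> 0"
    using Max_in[OF fin] \<open>\<not> (\<forall>k\<le>d. p k = 0)\<close> unfolding D_def by auto
  have above_D: "p k = 0" if "k \<le> d" "k > D" for k
  proof (rule ccontr)
    assume "p k \<noteq> 0"
    then have "k \<le> D" unfolding D_def by (intro Max_ge fin) (use that in simp)
    then show False using that by simp
  qed
  assume "\<forall>\<^sub>F n in sequentially. (\<Sum>k\<le>d. poly (p k) (of_nat n) * of_real (exp (c * real (n - k) powr \<theta>))) = 0"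
  then obtain N where N: "\<And>n. n \<ge> N \<Longrightarrow> 
      (\<Sum>k\<le>d. poly (p k) (of_nat n) * of_real (exp (c * real (n - k) powr \<theta>))) = 0"
    unfolding eventually_sequentially by blast
  have F: "(\<Sum>k<Suc D. poly (p k) (of_real (real n)) * of_real (exp (c * (real n - real k) powr \<theta>))) = 0"
    if n: "n \<ge> max N d" for n
  proof -
    have "(\<Sum>k<Suc D. poly (p k) (of_nat n) * of_real (exp (c * (real n - real k) powr \<theta>))) =
          (\<Sum>k\<le>d. poly (p k) (of_nat n) * of_real (exp (c * real (n - k) powr \<theta>)))"
    proof (rule sum.mono_neutral_cong_left)
      fix k assume "k \<in> {..<Suc D}"
      then show "poly (p k) (of_nat n) * of_real (exp (c * (real n - real k) powr \<theta>)) =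
            poly (p k) (of_nat n) * of_real (exp (c * real (n - k) powr \<theta>))"
        using D(1) n by (simp add: of_nat_diff)
    qed (use D(1) above_D in auto)
    then show ?thesis using N[of n] n by simp
  qed
  have "(\<Sum>k<Suc D. poly (map_poly Re (p k)) (real n) * exp (c * (real n - real k) powr \<theta>)) = 0"
    if n: "n \<ge> max N d" for n
    using arg_cong[OF F[OF n], of Re] unfolding Re_sum
    by (simp add: Re_poly_of_real[symmetric] del: sum.lessThan_Suc)
  then have re: "\<forall>\<^sub>F x in at_top. (\<Sum>k<Suc D. poly (map_poly Re (p k)) x * exp (c * (x - real k) powr \<theta>)) = 0"
    by (rule exp_power_sum_eventually_zero)
  have "(\<Sum>k<Suc D. poly (map_poly Im (p k)) (real n) * exp (c * (real n - real k) powr \<theta>)) = 0"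
    if n: "n \<ge> max N d" for n
    using arg_cong[OF F[OF n], of Im] unfolding Im_sum
    by (simp add: Im_poly_of_real[symmetric] del: sum.lessThan_Suc)
  then have im: "\<forall>\<^sub>F x in at_top. (\<Sum>k<Suc D. poly (map_poly Im (p k)) x * exp (c * (x - real k) powr \<theta>)) = 0"
    by (rule exp_power_sum_eventually_zero)
  have ev: "\<forall>\<^sub>F x in at_top. (\<Sum>k\<le>D. poly (p k) (of_real x) * of_real (exp (c * (x - real k) powr \<theta>))) = 0"
    using re im
    by eventually_elim (simp add: complex_eq_iff Re_poly_of_real Im_poly_of_real lessThan_Suc_atMost del: sum.lessThan_Suc)
  obtain Q G where QG: "Q \<noteq> 0" "G holomorphic_on ball 0 1"
    "\<And>t. Re t < 0 \<Longrightarrow> poly Q (exp t) * exp (of_real c * exp (of_real \<theta> * t)) = G (exp t)"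
    using exp_power_sum_singular_term[OF ev D(2)] by blast
  show False
  proof (cases "\<theta> < 0")
    case True
    then show False using exp_negative_power_unbounded[OF QG(3,2,1) c] by simp
  next
    case False
    then show False using exp_power_not_single_valued[OF QG(3,1) c] \<theta> by simp
  qed
qed


lemma not_holonomic_exp_power:
  fixes c \<theta> :: real
  assumes "c \<noteq> 0" and "\<theta> \<notin> {0, 1}"
  shows "\<not> holonomic_from m (\<lambda>n. of_real (exp (c * real n powr \<theta>)))"
  using assms not_holonomic_exp_power_less_1[of c \<theta>] not_holonomic_exp_power_greater_1[of c \<theta>]
  by (cases "\<theta> < 1") auto

theorem theorem1:
  shows "(\<forall>c \<theta> :: real. c \<noteq> 0 \<and> \<theta> \<notin> {0, 1} \<longrightarrow>
            \<not> holonomic_from 1 (\<lambda>n. of_real (exp (c * real n powr \<theta>)))) \<and>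
         \<not> holonomic_from 1 (\<lambda>n. of_real (exp (sqrt (real n)))) \<and>
         \<not> holonomic_from 1 (\<lambda>n. of_real (exp (- sqrt (real n)))) \<and>
         \<not> holonomic_from 1 (\<lambda>n. of_real (exp (1 / real n))) \<and>
         \<not> holonomic_from 1 (\<lambda>n. of_real (exp (- (1 / real n)))) \<and>
         \<not> holonomic_from 1 (\<lambda>n. 1 / (2 ^ n + 1)) \<and>
         \<not> holonomic_from 1 (\<lambda>n. 1 / (2 ^ n - 1)) \<and>
         \<not> holonomic_from 1 (\<lambda>n. 1 / (fact n + 1)) \<and>
         \<not> holonomic_from 1 (\<lambda>n. of_real (Gamma (real n * sqrt 2))) \<and>
         \<not> holonomic_from 1 (\<lambda>n. of_real (Gamma (real n * sqrt 2) / Gamma (real n * sqrt 3))) \<and>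
         \<not> holonomic_from 1 (\<lambda>n. Gamma (of_nat n * \<i>)) \<and>
         \<not> holonomic_from 1 (\<lambda>n. 1 / zeta (of_nat n + 2))"
proof (intro conjI)
  show "\<forall>c \<theta> :: real. c \<noteq> 0 \<and> \<theta> \<notin> {0, 1} \<longrightarrow>
            \<not> holonomic_from 1 (\<lambda>n. of_real (exp (c * real n powr \<theta>)))"
    using not_holonomic_exp_power by blast
  have exp_power: "\<not> holonomic_from 1 (\<lambda>n. of_real (exp (g n)))"
    if "\<And>n. n \<ge> 1 \<Longrightarrow> g n = c * real n powr \<theta>" "c \<noteq> 0" "\<theta> \<notin> {0, 1}" for g :: "nat \<Rightarrow> real" and c \<theta>
    using not_holonomic_exp_power[of c \<theta> 1] that
      holonomic_from_cong[of 1 "\<lambda>n. of_real (exp (g n))" "\<lambda>n. of_real (exp (c * real n powr \<theta>))"] by simp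
  show "\<not> holonomic_from 1 (\<lambda>n. of_real (exp (sqrt (real n))))"
    by (rule exp_power[of _ 1 "1 / 2"]) (auto simp: powr_half_sqrt)
  show "\<not> holonomic_from 1 (\<lambda>n. of_real (exp (- sqrt (real n))))"
    by (rule exp_power[of _ "- 1" "1 / 2"]) (auto simp: powr_half_sqrt)
  show "\<not> holonomic_from 1 (\<lambda>n. of_real (exp (1 / real n)))"
    by (rule exp_power[of _ 1 "- 1"]) (auto simp: powr_minus_divide)
  show "\<not> holonomic_from 1 (\<lambda>n. of_real (exp (- (1 / real n))))"
    by (rule exp_power[of _ "- 1" "- 1"]) (auto simp: powr_minus_divide)
  show "\<not> holonomic_from 1 (\<lambda>n. 1 / (2 ^ n + 1))" "\<not> holonomic_from 1 (\<lambda>n. 1 / (2 ^ n - 1))"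
    using not_holonomic_reciprocal_power_of_2[of 1 1] not_holonomic_reciprocal_power_of_2[of "- 1" 1] by simp_all
  show "\<not> holonomic_from 1 (\<lambda>n. 1 / (fact n + 1))"
    by (rule not_holonomic_reciprocal_fact_plus_1)
  have Gamma_real: "of_real (Gamma (real n * x)) = Gamma (of_nat n * complex_of_real x)" for n x
    using Gamma_complex_of_real[of "real n * x"] by simp
  have sqrt_2: "sqrt 2 \<notin> \<rat>" using sqrt_prime_irrational[OF two_is_prime_nat] by simp
  show "\<not> holonomic_from 1 (\<lambda>n. of_real (Gamma (real n * sqrt 2)))"
    unfolding Gamma_real by (rule not_holonomic_Gamma_multiples) (use sqrt_2 in simp_all)
  have "complex_of_real (sqrt 2) - of_real (sqrt 3) \<notin> \<rat>"
    using sqrt_2_minus_sqrt_3_irrational by (simp flip: of_real_diff)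
  then show "\<not> holonomic_from 1 (\<lambda>n. of_real (Gamma (real n * sqrt 2) / Gamma (real n * sqrt 3)))"
    unfolding of_real_divide Gamma_real by (intro not_holonomic_Gamma_multiples_quotient) auto
  show "\<not> holonomic_from 1 (\<lambda>n. Gamma (of_nat n * \<i>))"
    by (rule not_holonomic_Gamma_multiples) (auto simp: imaginary_unit_irrational)
  show "\<not> holonomic_from 1 (\<lambda>n. 1 / zeta (of_nat n + 2))"
    by (rule not_holonomic_inverse_zeta)
qed

end
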